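(* Consider an $s$-stage explicit Runge-Kutta method with polynomial $\mathcal{P}_s(z)=1+z+a_2z^2+\ldots+a_sz^s$, $a_k\in\mathbb{R}$, $a_s\neq 0$, and assume it satisfies the imaginary interval condition: there exists $R_s>0$ such that $$\max_{-R_s\leq\sigma\leq R_s}|\mathcal{P}_s(i\sigma)|\leq 1.$$ Then there exists a constant $0<\mathcal{C}_s<R_s$ (depending only on the Runge-Kutta method, in particular independent of $N$ and of $\mathbb{L}_N$) such that for all negative matrices $\mathbb{L}_N$, i.e. all $N\times N$ real matrices $\mathbb{L}_N$ for which there is a real symmetric matrix $\mathbb{H}_N$ with $$\mathbb{L}_N^\top\mathbb{H}_N+\mathbb{H}_N\mathbb{L}_N\leq 0,\qquad 0<K_{\mathbb{H}}^{-1}\leq\mathbb{H}_N\leq K_{\mathbb{H}},$$ with a constant $K_{\mathbb{H}}$ independent of $N$, the Runge-Kutta method $$\mathbf{u}_{n+1}=\mathcal{P}_s(\Delta t\,\mathbb{L}_N)\mathbf{u}_n,\qquad n=0,1,2,\ldots,$$ is stable under the CFL condition $\Delta t\cdot r_{\mathbb{H}_N}(\mathbb{L}_N)\leq \mathcal{C}_s$ $(\Delta t>0)$; namely, under this condition, for arbitrary initial data $\mathbf{u}_0$, $$|\mathbf{u}_n|_{\ell^2}\leq (1+\sqrt{2})\,K_{\mathbb{H}}\,|\mathbf{u}_0|_{\ell^2},\qquad n=1,2,\ldots.$$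
   Context: For a positive definite $N\times N$ matrix $H$, let $\langle \mathbf{x},\mathbf{y}\rangle_H:=\mathbf{x}^*H\mathbf{y}$ and $|\mathbf{x}|_H^2:=\langle \mathbf{x},\mathbf{x}\rangle_H$ on $\mathbb{C}^N$. The $H$-weighted numerical radius of $A\in M_N(\mathbb{C})$ is $r_H(A):=\max_{|\mathbf{x}|_H=1}|\langle A\mathbf{x},\mathbf{x}\rangle_H|$. $|\cdot|_{\ell^2}$ is the Euclidean norm. Matrix inequalities are in the sense of quadratic forms, with a scalar $c$ standing for $c\,\mathbb{I}$. *)

theory Defs
  imports
    "HOL-Analysis.L2_Norm"
    "HOL-Computational_Algebra.Polynomial"
    "Jordan_Normal_Form.Matrix"
begin

text \<open>
  The dimension \<open>N\<close> is quantified inside the scope of the CFL constant, so matrices and vectors are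
  those of \<open>Jordan_Normal_Form.Matrix\<close> with explicit carriers. Real matrices act on \<open>\<complex>\<^sup>N\<close> through
  their complexification.
\<close>

abbreviation cmat :: "real mat \<Rightarrow> complex mat" where
  "cmat \<equiv> map_mat complex_of_real"

text \<open>Entrywise form of \<open>\<Sum>k\<le>degree p. coeff p k \<cdot>\<^sub>m A ^\<^sub>m k\<close> for a square matrix \<open>A\<close>.\<close>

definition mat_poly :: "'a::comm_semiring_1 poly \<Rightarrow> 'a mat \<Rightarrow> 'a mat" where
  "mat_poly p A = mat (dim_row A) (dim_row A)
     (\<lambda>(i, j). \<Sum>k\<le>Polynomial.degree p. Polynomial.coeff p k * (A ^\<^sub>m k) $$ (i, j))"

text \<open>\<open>A \<le> B\<close> as quadratic forms on \<open>\<real>\<^sup>N\<close>; meant for symmetric \<open>A\<close> and \<open>B\<close>.\<close>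

definition quad_le :: "nat \<Rightarrow> real mat \<Rightarrow> real mat \<Rightarrow> bool" where
  "quad_le N A B \<longleftrightarrow> (\<forall>x\<in>carrier_vec N. x \<bullet> (A *\<^sub>v x) \<le> x \<bullet> (B *\<^sub>v x))"

definition weighted_inner :: "complex mat \<Rightarrow> complex vec \<Rightarrow> complex vec \<Rightarrow> complex" where
  "weighted_inner H x y = conjugate x \<bullet> (H *\<^sub>v y)"

text \<open>For positive definite \<open>H\<close> the value \<open>weighted_inner H x x\<close> is real and nonnegative.\<close>

definition weighted_norm :: "complex mat \<Rightarrow> complex vec \<Rightarrow> real" where
  "weighted_norm H x = sqrt (Re (weighted_inner H x x))"

text \<open>
  The supremum is a maximum when \<open>H\<close> is positive definite of size \<open>N \<ge> 1\<close>, because the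
  \<open>H\<close>-unit sphere is then nonempty and compact.
\<close>

definition numerical_radius :: "complex mat \<Rightarrow> complex mat \<Rightarrow> real" where
  "numerical_radius H A =
     (SUP x\<in>{x \<in> carrier_vec (dim_row H). weighted_norm H x = 1}. cmod (weighted_inner H (A *\<^sub>v x) x))"

definition l2_norm :: "complex vec \<Rightarrow> real" where
  "l2_norm v = L2_set (\<lambda>i. cmod (v $ i)) {..<dim_vec v}"

end

theory Submission
  imports "HOL-Complex_Analysis.Cauchy_Integral_Theorem" Defs "Jordan_Normal_Form.Determinant"
begin

text \<open>
  The matrix \<open>A = dt L\<close> is dissipative for the weighted inner product and has numerical radius at
  most \<open>C\<close>, so its numerical range lies in a small left half disc. Two facts give the theorem.

  First, the condition on the imaginary interval makes \<open>\<bar>p\<bar> \<le> 1\<close> on a whole left half disc about the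
  origin: because \<open>p 0 = p' 0 = 1\<close>, the modulus of \<open>p\<close> near \<open>0\<close> decreases when the argument moves to the
  left (lemma \<open>half_disc_stability\<close>).

  Second, for \<open>f = p\<^sup>n\<close>, which is bounded by \<open>1\<close> on the left half disc of radius \<open>\<rho>\<close>, the operator norm
  of \<open>f A\<close> is at most \<open>2 \<rho> / (\<rho> - C)\<close>; this is below \<open>1 + \<surd>2\<close> once \<open>C\<close> is a small multiple of \<open>\<rho>\<close>. The
  estimate (lemmas \<open>half_disc_contour_bound\<close> and \<open>power_bound\<close>) comes from the representation of
  \<open>2 \<pi> \<i> f A\<close> as the integral of \<open>f z (z - A)\<^sup>-\<^sup>1\<close> over the circle of radius \<open>\<rho>\<close>. On the left arc the
  integrand is at most \<open>1 / (\<rho> - C)\<close>. The right arc is deformed to the vertical diameter, and there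
  the resolvent \<open>R\<close> is written as \<open>(R + R\<^sup>*) - R\<^sup>*\<close>. Dissipativity makes \<open>R + R\<^sup>*\<close> a positive form on
  the imaginary axis, so that its integral against \<open>f\<close> is controlled by its integral against \<open>1\<close>,
  which is moved back to the right arc. Since \<open>p\<close> has real coefficients, the adjoint of the
  remaining integral is, up to sign, the integral of \<open>f (- z) R z\<close> along the diameter; this is again
  moved to the right arc, where \<open>- z\<close> lies in the left half disc.

  To have a resolvent on the imaginary axis, \<open>A\<close> is replaced by \<open>A - \<delta>\<close> and \<open>f\<close> by \<open>f (\<cdot> + \<delta>)\<close> for
  a small positive \<open>\<delta>\<close>. Finally, comparing the weighted norm with the Euclidean one costs the
  factor \<open>\<surd>K\<close> twice.
\<close>

section \<open>Contour integrals over half discs\<close>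

text \<open>
  The circle of radius \<open>\<rho>\<close> about \<open>0\<close> starts at \<open>- \<i> \<rho>\<close>, so that it is the right half circle
  followed by the left one. The vertical segment runs upwards between the same end points as
  the right half circle.
\<close>

abbreviation right_arc :: "real \<Rightarrow> real \<Rightarrow> complex" where
  "right_arc \<rho> \<equiv> part_circlepath 0 \<rho> (- (pi / 2)) (pi / 2)"

abbreviation left_arc :: "real \<Rightarrow> real \<Rightarrow> complex" where
  "left_arc \<rho> \<equiv> part_circlepath 0 \<rho> (pi / 2) (3 * pi / 2)"

abbreviation full_circle :: "real \<Rightarrow> real \<Rightarrow> complex" where
  "full_circle \<rho> \<equiv> part_circlepath 0 \<rho> (- (pi / 2)) (3 * pi / 2)"

abbreviation vertical_seg :: "real \<Rightarrow> real \<Rightarrow> complex" where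
  "vertical_seg \<rho> \<equiv> linepath (- (\<i> * of_real \<rho>)) (\<i> * of_real \<rho>)"

lemma contour_integral_full_circle:
  assumes "f contour_integrable_on full_circle \<rho>"
  shows "contour_integral (full_circle \<rho>) f
    = contour_integral (left_arc \<rho>) f + contour_integral (right_arc \<rho>) f"
proof -
  have p: "- (pi/2) < pi/2" "pi/2 < 3*pi/2" "- (pi/2) < 3*pi/2"
    using pi_gt_zero by linarith+
  show ?thesis
    using assms p
    unfolding contour_integral_part_circlepath_eq[OF p(1)] contour_integral_part_circlepath_eq[OF p(2)]
       contour_integral_part_circlepath_eq[OF p(3)] contour_integrable_part_circlepath_iff[OF p(3)]
    by (subst Henstock_Kurzweil_Integration.integral_combine[symmetric, of _ "pi/2"]) (auto simp: add.commute)
qed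

lemma contour_integrable_on_circle_arc:
  assumes "continuous_on (sphere 0 \<rho>) f" "0 \<le> \<rho>"
  shows "f contour_integrable_on part_circlepath 0 \<rho> s t"
  using assms path_image_part_circlepath_subset'[of \<rho> 0 s t]
  by (intro contour_integrable_continuous_part_circlepath) (auto intro: continuous_on_subset)

lemma contour_integral_half_circle_bound:
  assumes "continuous_on (sphere 0 \<rho>) f" "0 \<le> \<rho>" "0 \<le> M" "\<bar>t - s\<bar> = pi"
    and "\<And>z. z \<in> path_image (part_circlepath 0 \<rho> s t) \<Longrightarrow> cmod (f z) \<le> M"
  shows "cmod (contour_integral (part_circlepath 0 \<rho> s t) f) \<le> pi * \<rho> * M"
  using contour_integral_bound_part_circlepath[OF contour_integrable_on_circle_arc[OF assms(1,2), of s t] assms(3,2)]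
    assms(4,5) by (simp add: mult_ac)

lemma right_arc_image:
  assumes "0 \<le> \<rho>" "z \<in> path_image (right_arc \<rho>)"
  shows "0 \<le> Re z" "cmod z = \<rho>"
  using assms path_image_part_circlepath_subset'[of \<rho> 0 "- (pi / 2)" "pi/2"]
  by (auto simp: path_image_part_circlepath' closed_segment_eq_real_ivl cos_ge_zero)

lemma left_arc_image:
  assumes "0 \<le> \<rho>" "z \<in> path_image (left_arc \<rho>)"
  shows "Re z \<le> 0" "cmod z = \<rho>"
proof -
  show "cmod z = \<rho>" using assms path_image_part_circlepath_subset'[of \<rho> 0 "pi / 2" "3*pi/2"] by auto
  obtain x where x: "pi/2 \<le> x" "x \<le> 3*pi/2" "z = \<rho> * cis x"
    using assms by (auto simp: path_image_part_circlepath' closed_segment_eq_real_ivl)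
  have "cos x = - cos (x - pi)" by simp
  moreover have "cos (x - pi) \<ge> 0" using x by (intro cos_ge_zero) auto
  ultimately have "cos x \<le> 0" by linarith
  then show "Re z \<le> 0" using x assms by (simp add: mult_nonneg_nonpos)
qed

lemma vertical_seg_integral_eq_right_arc_integral:
  assumes hol: "g holomorphic_on {z. - \<delta> < Re z}" and "0 < \<delta>" "0 < \<rho>"
  shows "contour_integral (vertical_seg \<rho>) g = contour_integral (right_arc \<rho>) g"
proof -
  let ?S = "{z. - \<delta> < Re z}"
  have e: "cis (pi / 2) = \<i>" "cis (- (pi / 2)) = - \<i>"
    by (rule cis_pi_half, metis cis_cnj cis_pi_half complex_cnj_i)
  have comm: "x * \<i> = \<i> * x" "x * - \<i> = - (\<i> * x)" for x :: complex
    by (rule mult.commute, metis mult.commute mult_minus_right)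
  have ends: "pathfinish (right_arc \<rho>) = \<i> * \<rho>" "pathstart (right_arc \<rho>) = - (\<i> * \<rho>)"
    unfolding pathfinish_part_circlepath pathstart_part_circlepath cis_conv_exp[symmetric] e add_0_left comm
    by (rule refl)+
  have cont: "continuous_on ?S g" using hol by (rule holomorphic_on_imp_continuous_on)
  have s1: "path_image (vertical_seg \<rho>) \<subseteq> ?S"
    using assms(2) by (auto simp: closed_segment_def)
  have s2: "path_image (right_arc \<rho>) \<subseteq> ?S"
    using right_arc_image(1)[of \<rho>] assms(2,3) by force
  have i1: "g contour_integrable_on (vertical_seg \<rho>)"
    using cont s1 by (intro contour_integrable_continuous_linepath) (auto intro: continuous_on_subset)
  have i2: "g contour_integrable_on (right_arc \<rho>)"
    using cont s2 by (intro contour_integrable_continuous_part_circlepath) (auto intro: continuous_on_subset)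
  have join: "pathfinish (right_arc \<rho>) = pathstart (reversepath (vertical_seg \<rho>))"
    unfolding ends by simp
  let ?\<gamma> = "right_arc \<rho> +++ reversepath (vertical_seg \<rho>)"
  have "(g has_contour_integral 0) ?\<gamma>"
  proof (rule Cauchy_theorem_convex_simple[OF hol])
    show "convex ?S" by (rule convex_halfspace_Re_gt)
    show "valid_path ?\<gamma>" by (rule valid_path_join[OF _ _ join]) auto
    show "path_image ?\<gamma> \<subseteq> ?S" 
      by (rule subset_trans[OF path_image_join_subset])
        (use s1 s2 in \<open>simp only: path_image_reversepath Un_least\<close>)
    show "pathfinish ?\<gamma> = pathstart ?\<gamma>"
      unfolding pathfinish_join pathstart_join ends by simp
  qed
  then have "contour_integral ?\<gamma> g = 0" by (rule contour_integral_unique)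
  moreover have "contour_integral ?\<gamma> g = contour_integral (right_arc \<rho>) g + contour_integral (reversepath (vertical_seg \<rho>)) g"
    using i1 i2 by (intro contour_integral_join contour_integrable_reversepath) auto
  moreover have "contour_integral (reversepath (vertical_seg \<rho>)) g = - contour_integral (vertical_seg \<rho>) g"
    by (rule contour_integral_reversepath) simp
  ultimately show ?thesis by simp
qed

lemma contour_integral_full_circle_entire:
  assumes "f holomorphic_on UNIV"
  shows "contour_integral (full_circle \<rho>) f = 0"
proof (rule contour_integral_unique, rule Cauchy_theorem_convex_simple[OF assms])
  have "exp (\<i> * (3 * pi / 2)) = exp (\<i> * (- (pi/2)))"
    using exp_two_pi_i by (subst exp_eq) (auto intro!: exI[of _ 1] simp: field_simps)
  then show "pathfinish (full_circle \<rho>) = pathstart (full_circle \<rho>)" by simp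
qed auto

lemma contour_integral_full_circle_inverse_power:
  assumes "0 < \<rho>"
  shows "contour_integral (full_circle \<rho>) (\<lambda>z. 1 / z ^ Suc k) = (if k = 0 then 2 * pi * \<i> else 0)"
proof (cases "k = 0")
  case True
  have p: "- (pi/2) < 3*pi/2" using pi_gt_zero by linarith
  have "contour_integral (full_circle \<rho>) (\<lambda>z. 1 / z ^ Suc k) = integral {- (pi / 2)..3 * pi / 2} (\<lambda>t. \<i>)"
    unfolding contour_integral_part_circlepath_eq[OF p] True
    using assms by (intro integral_cong) (simp add: field_simps)
  also have "\<dots> = 2 * pi * \<i>" using p by (simp add: scaleR_conv_of_real)
  finally show ?thesis using True by simp
next
  case False
  then obtain m where m: "k = Suc m" by (cases k) auto
  have "exp (\<i> * (3 * pi / 2)) = exp (\<i> * (- (pi/2)))"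
    using exp_two_pi_i by (subst exp_eq) (auto intro!: exI[of _ 1] simp: field_simps)
  then have closed: "pathfinish (full_circle \<rho>) = pathstart (full_circle \<rho>)" by simp
  have "((\<lambda>z. 1 / z ^ Suc k) has_contour_integral 0) (full_circle \<rho>)"
  proof (rule Cauchy_theorem_primitive[where S = "- {0}", OF _ _ _ closed])
    fix z :: complex assume "z \<in> - {0}"
    then have "(inverse has_field_derivative - (inverse z ^ Suc (Suc 0))) (at z within - {0})"
      by (intro DERIV_inverse) simp
    from DERIV_power[OF this, of k]
    have "((\<lambda>z. inverse z ^ k) has_field_derivative of_nat k * (- (inverse z ^ Suc k))) (at z within - {0})"
      by (simp add: m mult.assoc)
    from DERIV_cmult[OF this, of "- (1 / of_nat k)"]
    have "((\<lambda>z. - (1 / of_nat k) * inverse z ^ k) has_field_derivative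
        - (1 / of_nat k) * (of_nat k * (- (inverse z ^ Suc k)))) (at z within - {0})" .
    moreover have "- (1 / of_nat k) * (of_nat k * (- (inverse z ^ Suc k))) = 1 / z ^ Suc k"
      using False by (simp add: divide_inverse power_inverse)
    ultimately
    show "((\<lambda>z. - (1 / of_nat k) * inverse z ^ k) has_field_derivative 1 / z ^ Suc k) (at z within - {0})"
      by (simp only:)
  qed (use assms path_image_part_circlepath_subset'[of \<rho> 0 "- (pi/2)" "3*pi/2"] in auto)
  then show ?thesis using False by (simp add: contour_integral_unique)
qed

text \<open>
  The scalar core of the argument. In the application \<open>a\<close> and \<open>b\<close> are the sesquilinear form of a
  resolvent evaluated at a pair of vectors in the two orders, and \<open>e\<close> is the sum of its two diagonal
  values, so that the last assumption is the positivity of the Hermitian part of the resolvent on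
  the imaginary axis. The three circular contributions (the left arc, the right arc of
  \<open>f (- z) * b z\<close>, and the right arc of \<open>e\<close>, whose bound is doubled) each have length \<open>pi * \<rho>\<close>.
\<close>

lemma half_disc_contour_bound:
  fixes a b e f :: "complex \<Rightarrow> complex"
  assumes rad: "0 \<le> r" "r < \<rho>" and "0 < \<delta>"
    and hol: "a holomorphic_on {z. - \<delta> < Re z \<or> r < cmod z}"
      "b holomorphic_on {z. - \<delta> < Re z \<or> r < cmod z}"
      "e holomorphic_on {z. - \<delta> < Re z \<or> r < cmod z}"
    and f: "f holomorphic_on UNIV" 
    and f_bound: "\<And>z. Re z \<le> 0 \<Longrightarrow> cmod z \<le> \<rho> \<Longrightarrow> cmod (f z) \<le> F"
    and f_cnj: "\<And>z. cnj (f z) = f (cnj z)"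
    and bound: "\<And>z. cmod z = \<rho> \<Longrightarrow> cmod (a z) \<le> M" "\<And>z. cmod z = \<rho> \<Longrightarrow> cmod (b z) \<le> M"
       "\<And>z. cmod z = \<rho> \<Longrightarrow> cmod (e z) \<le> 2 * M"
    and pos: "\<And>t. cmod (a (Complex 0 t) + cnj (b (Complex 0 t))) \<le> Re (e (Complex 0 t))"
  shows "cmod (contour_integral (full_circle \<rho>) (\<lambda>z. f z * a z)) \<le> 4 * pi * \<rho> * F * M"
proof -
  let ?U = "{z. - \<delta> < Re z \<or> r < cmod z}"
  have \<rho>: "0 < \<rho>" using rad by simp
  have F0: "0 \<le> F" using f_bound[of 0] norm_ge_zero \<rho> by (metis less_eq_real_def norm_zero order.trans zero_complex.simps(1))
  have M0: "0 \<le> M" using bound(1)[of "of_real \<rho>"] \<rho> norm_ge_zero by (metis abs_of_pos norm_of_real order.trans)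
  have sph: "continuous_on (sphere 0 \<rho>) g" if "g holomorphic_on ?U" for g
    by (rule continuous_on_subset[OF holomorphic_on_imp_continuous_on[OF that]]) (use rad in auto)
  have hp: "g holomorphic_on {z. - \<delta> < Re z}" if "g holomorphic_on ?U" for g
    using that by (rule holomorphic_on_subset) auto
  have f_sub: "f holomorphic_on S" for S using f by (rule holomorphic_on_subset) auto
  have fm: "(\<lambda>z. f (- z)) holomorphic_on S" for S
    using holomorphic_on_compose[OF holomorphic_on_minus[OF holomorphic_on_ident] f_sub] by (simp add: o_def)
  have fa: "(\<lambda>z. f z * a z) holomorphic_on ?U" using hol f_sub by (intro holomorphic_intros)
  have fb: "(\<lambda>z. f (- z) * b z) holomorphic_on ?U" using hol fm by (intro holomorphic_intros)
  have line: "continuous_on {-\<rho>..\<rho>} (\<lambda>t. g (Complex 0 t))" if "g holomorphic_on ?U" for g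
    by (rule continuous_on_compose2[OF holomorphic_on_imp_continuous_on[OF that]])
      (use assms(3) in \<open>auto simp: Complex_eq intro!: continuous_intros\<close>)
  have dia: "contour_integral (right_arc \<rho>) g = \<i> * integral {-\<rho>..\<rho>} (\<lambda>t. g (Complex 0 t))"
    if "g holomorphic_on ?U" for g
    using vertical_seg_integral_eq_right_arc_integral[OF hp[OF that] assms(3) \<rho>]
      contour_integral_linepath_same_Re[of "- (\<i> * of_real \<rho>)" 0 "\<i> * of_real \<rho>" "-\<rho>" \<rho> g] \<rho> by simp
  have L: "cmod (contour_integral (left_arc \<rho>) (\<lambda>z. f z * a z)) \<le> pi * \<rho> * (F * M)"
    using F0 M0 \<rho> left_arc_image[of \<rho>] f_bound bound(1)
    by (intro contour_integral_half_circle_bound[OF sph[OF fa]]) (auto simp: norm_mult intro!: mult_mono)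
  have B: "cmod (contour_integral (right_arc \<rho>) (\<lambda>z. f (- z) * b z)) \<le> pi * \<rho> * (F * M)"
    using F0 M0 \<rho> right_arc_image[of \<rho>] f_bound bound(2)
    by (intro contour_integral_half_circle_bound[OF sph[OF fb]]) (auto simp: norm_mult intro!: mult_mono)
  have E: "cmod (contour_integral (right_arc \<rho>) e) \<le> pi * \<rho> * (2 * M)"
    using M0 \<rho> right_arc_image[of \<rho>] bound(3)
    by (intro contour_integral_half_circle_bound[OF sph[OF hol(3)]]) auto
  let ?I = "integral {-\<rho>..\<rho>}"
  \<comment> \<open>On the imaginary axis \<open>cnj (f z) = f (- z)\<close>, which makes \<open>f z * cnj (b z)\<close> the conjugate of the
    boundary value of a function that is holomorphic in the right half disc.\<close>
  have b': "cnj (?I (\<lambda>t. f (- Complex 0 t) * b (Complex 0 t))) = ?I (\<lambda>t. f (Complex 0 t) * cnj (b (Complex 0 t)))"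
  proof -
    have "continuous_on {-\<rho>..\<rho>} (\<lambda>t. f (- Complex 0 t) * b (Complex 0 t))" by (rule line[OF fb])
    then have "cnj (?I (\<lambda>t. f (- Complex 0 t) * b (Complex 0 t))) = ?I (\<lambda>t. cnj (f (- Complex 0 t) * b (Complex 0 t)))"
      using integral_linear[OF integrable_continuous_real bounded_linear_cnj, of "-\<rho>" \<rho> "\<lambda>t. f (- Complex 0 t) * b (Complex 0 t)"]
      by (simp add: o_def)
    also have "\<dots> = ?I (\<lambda>t. f (Complex 0 t) * cnj (b (Complex 0 t)))"
    proof (rule integral_cong)
      fix t
      have "cnj (- Complex 0 t) = Complex 0 t" by (simp add: complex_eq_iff)
      then show "cnj (f (- Complex 0 t) * b (Complex 0 t)) = f (Complex 0 t) * cnj (b (Complex 0 t))"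
        by (simp add: f_cnj del: complex_cnj_minus)
    qed
    finally show ?thesis .
  qed
  have B': "cmod (?I (\<lambda>t. f (Complex 0 t) * cnj (b (Complex 0 t)))) \<le> pi * \<rho> * (F * M)"
    using B unfolding dia[OF fb] b'[symmetric] by (simp add: norm_mult)
  have cont: "continuous_on {-\<rho>..\<rho>} (\<lambda>t. f (Complex 0 t))" "continuous_on {-\<rho>..\<rho>} (\<lambda>t. a (Complex 0 t))"
     "continuous_on {-\<rho>..\<rho>} (\<lambda>t. b (Complex 0 t))" "continuous_on {-\<rho>..\<rho>} (\<lambda>t. e (Complex 0 t))"
    using line[OF f_sub] line hol by (auto intro!: continuous_intros)
  have P: "cmod (?I (\<lambda>t. f (Complex 0 t) * (a (Complex 0 t) + cnj (b (Complex 0 t))))) \<le> F * (pi * \<rho> * (2 * M))"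
  proof -
    have "cmod (?I (\<lambda>t. f (Complex 0 t) * (a (Complex 0 t) + cnj (b (Complex 0 t)))))
        \<le> ?I (\<lambda>t. F * Re (e (Complex 0 t)))"
    proof (rule integral_norm_bound_integral)
      show "(\<lambda>t. f (Complex 0 t) * (a (Complex 0 t) + cnj (b (Complex 0 t)))) integrable_on {-\<rho>..\<rho>}"
        using cont by (intro integrable_continuous_real continuous_intros)
      show "(\<lambda>t. F * Re (e (Complex 0 t))) integrable_on {-\<rho>..\<rho>}"
        using cont by (intro integrable_continuous_real continuous_intros)
      fix t assume t: "t \<in> {-\<rho>..\<rho>}"
      then have "cmod (f (Complex 0 t)) \<le> F" by (intro f_bound) (auto simp: cmod_def)
      then show "cmod (f (Complex 0 t) * (a (Complex 0 t) + cnj (b (Complex 0 t)))) \<le> F * Re (e (Complex 0 t))"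
        unfolding norm_mult using pos[of t] F0 by (intro mult_mono) auto
    qed
    also have "\<dots> = F * Re (?I (\<lambda>t. e (Complex 0 t)))"
      using integral_linear[OF integrable_continuous_real[OF cont(4)] bounded_linear_Re]
      by (simp add: o_def)
    also have "\<dots> \<le> F * (pi * \<rho> * (2 * M))"
      using E F0 complex_Re_le_cmod[of "?I (\<lambda>t. e (Complex 0 t))"] unfolding dia[OF hol(3)]
      by (intro mult_left_mono) (auto simp: norm_mult)
    finally show ?thesis .
  qed
  have "?I (\<lambda>t. f (Complex 0 t) * a (Complex 0 t))
     = ?I (\<lambda>t. f (Complex 0 t) * (a (Complex 0 t) + cnj (b (Complex 0 t))) - f (Complex 0 t) * cnj (b (Complex 0 t)))"
    by (simp add: algebra_simps)
  also have "\<dots> = ?I (\<lambda>t. f (Complex 0 t) * (a (Complex 0 t) + cnj (b (Complex 0 t)))) 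
     - ?I (\<lambda>t. f (Complex 0 t) * cnj (b (Complex 0 t)))"
    using cont by (intro Henstock_Kurzweil_Integration.integral_diff integrable_continuous_real continuous_intros)
  finally have eq: "?I (\<lambda>t. f (Complex 0 t) * a (Complex 0 t))
    = ?I (\<lambda>t. f (Complex 0 t) * (a (Complex 0 t) + cnj (b (Complex 0 t))))
      - ?I (\<lambda>t. f (Complex 0 t) * cnj (b (Complex 0 t)))" .
  have "cmod (?I (\<lambda>t. f (Complex 0 t) * a (Complex 0 t))) \<le> F * (pi * \<rho> * (2 * M)) + pi * \<rho> * (F * M)"
    unfolding eq by (rule order.trans[OF norm_triangle_ineq4 add_mono[OF P B']])
  then have R: "cmod (contour_integral (right_arc \<rho>) (\<lambda>z. f z * a z)) \<le> F * (pi * \<rho> * (2 * M)) + pi * \<rho> * (F * M)"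
    unfolding dia[OF fa] by (simp add: norm_mult)
  have "cmod (contour_integral (full_circle \<rho>) (\<lambda>z. f z * a z))
     \<le> pi * \<rho> * (F * M) + (F * (pi * \<rho> * (2 * M)) + pi * \<rho> * (F * M))"
    unfolding contour_integral_full_circle[OF contour_integrable_on_circle_arc[OF sph[OF fa] less_imp_le[OF \<rho>]]]
    by (rule order.trans[OF norm_triangle_ineq add_mono[OF L R]])
  then show ?thesis by (simp add: algebra_simps)
qed

section \<open>Sesquilinear forms and resolvents\<close>

lemma weighted_inner_sum:
  assumes "M \<in> carrier_mat N N" "x \<in> carrier_vec N" "y \<in> carrier_vec N"
  shows "weighted_inner M x y = (\<Sum>i<N. \<Sum>j<N. cnj (x $ i) * M $$ (i, j) * y $ j)"
  using assms unfolding weighted_inner_def scalar_prod_def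
  by (auto simp: scalar_prod_def sum_distrib_left atLeast0LessThan mult.assoc intro!: sum.cong)

lemma weighted_inner_add_right:
  assumes "M \<in> carrier_mat N N" "x \<in> carrier_vec N" "y \<in> carrier_vec N" "z \<in> carrier_vec N"
  shows "weighted_inner M x (y + z) = weighted_inner M x y + weighted_inner M x z"
  using assms by (simp add: weighted_inner_sum[of M N] sum.distrib algebra_simps)

lemma weighted_inner_add_left:
  assumes "M \<in> carrier_mat N N" "x \<in> carrier_vec N" "y \<in> carrier_vec N" "z \<in> carrier_vec N"
  shows "weighted_inner M (y + z) x = weighted_inner M y x + weighted_inner M z x"
  using assms by (simp add: weighted_inner_sum[of M N] sum.distrib algebra_simps)

lemma weighted_inner_smult_right:
  assumes "M \<in> carrier_mat N N" "x \<in> carrier_vec N" "y \<in> carrier_vec N"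
  shows "weighted_inner M x (c \<cdot>\<^sub>v y) = c * weighted_inner M x y"
  using assms by (simp add: weighted_inner_sum[of M N] sum_distrib_left mult_ac)

lemma weighted_inner_smult_left:
  assumes "M \<in> carrier_mat N N" "x \<in> carrier_vec N" "y \<in> carrier_vec N"
  shows "weighted_inner M (c \<cdot>\<^sub>v y) x = cnj c * weighted_inner M y x"
  using assms by (simp add: weighted_inner_sum[of M N] sum_distrib_left mult_ac)

lemmas weighted_inner_linear = weighted_inner_add_right weighted_inner_add_left
  weighted_inner_smult_right weighted_inner_smult_left

lemma weighted_inner_mult:
  assumes "M \<in> carrier_mat N N" "T \<in> carrier_mat N N" "y \<in> carrier_vec N"
  shows "weighted_inner (M * T) x y = weighted_inner M x (T *\<^sub>v y)"
  using assms by (simp add: weighted_inner_def)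

text \<open>
  Expanding the form at \<open>x + \<omega> y\<close> with a unimodular \<open>\<omega>\<close> that makes the cross terms real and
  nonpositive.
\<close>

lemma weighted_inner_polarization:
  assumes M: "M \<in> carrier_mat N N" and x: "x \<in> carrier_vec N" and y: "y \<in> carrier_vec N"
    and nonneg: "\<And>v. v \<in> carrier_vec N \<Longrightarrow> 0 \<le> Re (weighted_inner M v v)"
  shows "cmod (weighted_inner M x y + cnj (weighted_inner M y x))
    \<le> Re (weighted_inner M x x) + Re (weighted_inner M y y)"
proof -
  define s where "s = weighted_inner M x y + cnj (weighted_inner M y x)"
  define \<omega> where "\<omega> = (if s = 0 then 1 else - cnj (sgn s))"
  have n: "cnj \<omega> * \<omega> = 1"
    using complex_norm_square[of \<omega>] by (auto simp: \<omega>_def norm_sgn mult.commute)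
  have s: "\<omega> * s = - of_real (cmod s)"
    by (auto simp: \<omega>_def sgn_eq complex_norm_square[symmetric] power2_eq_square mult.commute[of "cnj s"])
  have "0 \<le> Re (weighted_inner M (x + \<omega> \<cdot>\<^sub>v y) (x + \<omega> \<cdot>\<^sub>v y))"
    using x y by (intro nonneg) auto
  also have "weighted_inner M (x + \<omega> \<cdot>\<^sub>v y) (x + \<omega> \<cdot>\<^sub>v y)
     = weighted_inner M x x + \<omega> * weighted_inner M x y + cnj \<omega> * weighted_inner M y x + cnj \<omega> * \<omega> * weighted_inner M y y"
    using M x y by (simp add: weighted_inner_linear[of M N] algebra_simps)
  also have "Re \<dots> = Re (weighted_inner M x x) + Re (weighted_inner M y y) + Re (\<omega> * s)"
    unfolding n s_def by (simp add: algebra_simps)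
  finally show ?thesis unfolding s by (simp add: s_def)
qed

text \<open>
  The matrix \<open>(z - B)\<^sup>-\<^sup>1\<close>, written with the adjugate so that its entries are visibly rational
  functions of \<open>z\<close>. It is the zero matrix when \<open>z\<close> is an eigenvalue of \<open>B\<close>.
\<close>

definition resolvent :: "complex mat \<Rightarrow> complex \<Rightarrow> complex mat" where
  "resolvent B z = (let C = z \<cdot>\<^sub>m 1\<^sub>m (dim_row B) - B in inverse (det C) \<cdot>\<^sub>m adj_mat C)"

lemma resolvent_carrier [simp]: "B \<in> carrier_mat N N \<Longrightarrow> resolvent B z \<in> carrier_mat N N"
  by (auto simp: resolvent_def Let_def intro!: smult_carrier_mat adj_mat(1))

lemma resolvent_inverse:
  assumes B: "B \<in> carrier_mat N N" and "det (z \<cdot>\<^sub>m 1\<^sub>m N - B) \<noteq> 0"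
  shows "(z \<cdot>\<^sub>m 1\<^sub>m N - B) * resolvent B z = 1\<^sub>m N" "resolvent B z * (z \<cdot>\<^sub>m 1\<^sub>m N - B) = 1\<^sub>m N"
proof -
  have C: "z \<cdot>\<^sub>m 1\<^sub>m N - B \<in> carrier_mat N N" using B by auto
  have d: "dim_row B = N" using B by auto
  show "(z \<cdot>\<^sub>m 1\<^sub>m N - B) * resolvent B z = 1\<^sub>m N" "resolvent B z * (z \<cdot>\<^sub>m 1\<^sub>m N - B) = 1\<^sub>m N"
    using assms adj_mat[OF C] C unfolding resolvent_def Let_def d
    by (auto simp: mult_smult_distrib[OF C] mult_smult_assoc_mat[OF _ C])
qed

lemma smult_mat_mult_vec:
  assumes "A \<in> carrier_mat N N" "v \<in> carrier_vec N"
  shows "(k \<cdot>\<^sub>m A) *\<^sub>v v = k \<cdot>\<^sub>v (A *\<^sub>v v)"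
  using assms by (auto simp: scalar_prod_def sum_distrib_left mult.assoc)

lemma char_matrix_apply:
  fixes B :: "'a::comm_ring_1 mat"
  assumes "B \<in> carrier_mat N N" "v \<in> carrier_vec N"
  shows "(z \<cdot>\<^sub>m 1\<^sub>m N - B) *\<^sub>v v = z \<cdot>\<^sub>v v - B *\<^sub>v v"
  using assms by (subst minus_mult_distrib_mat_vec[of _ N N]) (auto simp: smult_mat_mult_vec[of _ N])

lemma resolvent_apply:
  assumes B: "B \<in> carrier_mat N N" and "det (z \<cdot>\<^sub>m 1\<^sub>m N - B) \<noteq> 0" and x: "x \<in> carrier_vec N"
  shows "z \<cdot>\<^sub>v (resolvent B z *\<^sub>v x) = x + B *\<^sub>v (resolvent B z *\<^sub>v x)"
    and "z \<cdot>\<^sub>v (resolvent B z *\<^sub>v x) = x + resolvent B z *\<^sub>v (B *\<^sub>v x)"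
proof -
  have C: "z \<cdot>\<^sub>m 1\<^sub>m N - B \<in> carrier_mat N N" using B by auto
  have R: "resolvent B z \<in> carrier_mat N N" using B by simp
  note app = char_matrix_apply[OF B]
  have Rx: "resolvent B z *\<^sub>v x \<in> carrier_vec N" and Bx: "B *\<^sub>v x \<in> carrier_vec N" and
    BRx: "B *\<^sub>v (resolvent B z *\<^sub>v x) \<in> carrier_vec N"  and RBx: "resolvent B z *\<^sub>v (B *\<^sub>v x) \<in> carrier_vec N"
    using B R x by (auto intro!: mult_mat_vec_carrier)
  have zRx: "z \<cdot>\<^sub>v (resolvent B z *\<^sub>v x) \<in> carrier_vec N" using Rx by simp
  have move: "a = x + b" if "x = a - b" "a \<in> carrier_vec N" "b \<in> carrier_vec N" for a b :: "complex vec"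
    using that by (auto simp: vec_eq_iff)
  have "x = ((z \<cdot>\<^sub>m 1\<^sub>m N - B) * resolvent B z) *\<^sub>v x" using resolvent_inverse(1)[OF assms(1,2)] x by simp
  also have "\<dots> = z \<cdot>\<^sub>v (resolvent B z *\<^sub>v x) - B *\<^sub>v (resolvent B z *\<^sub>v x)"
    using C R x by (simp add: app[OF Rx])
  finally show "z \<cdot>\<^sub>v (resolvent B z *\<^sub>v x) = x + B *\<^sub>v (resolvent B z *\<^sub>v x)"
    using move zRx BRx by blast
  have "x = (resolvent B z * (z \<cdot>\<^sub>m 1\<^sub>m N - B)) *\<^sub>v x" using resolvent_inverse(2)[OF assms(1,2)] x by simp
  also have "\<dots> = z \<cdot>\<^sub>v (resolvent B z *\<^sub>v x) - resolvent B z *\<^sub>v (B *\<^sub>v x)"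
    using C R x Bx by (simp add: app mult_minus_distrib_mat_vec mult_mat_vec)
  finally show "z \<cdot>\<^sub>v (resolvent B z *\<^sub>v x) = x + resolvent B z *\<^sub>v (B *\<^sub>v x)"
    using move zRx RBx by blast
qed

lemma det_holomorphic:
  assumes "\<And>z. C z \<in> carrier_mat n n"
    and "\<And>i j. i < n \<Longrightarrow> j < n \<Longrightarrow> (\<lambda>z. C z $$ (i, j)) holomorphic_on S"
  shows "(\<lambda>z. det (C z)) holomorphic_on S"
  unfolding det_def'[OF assms(1)]
  by (intro holomorphic_on_sum holomorphic_on_mult holomorphic_on_const holomorphic_on_prod assms(2))
    (auto simp: permutes_in_image)

lemma resolvent_holomorphic:
  assumes B: "B \<in> carrier_mat N N" and "\<And>z. z \<in> S \<Longrightarrow> det (z \<cdot>\<^sub>m 1\<^sub>m N - B) \<noteq> 0" and ij: "i < N" "j < N"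
  shows "(\<lambda>z. resolvent B z $$ (i, j)) holomorphic_on S"
proof -
  have d: "dim_row B = N" "dim_col B = N" using B by auto
  have C: "(\<lambda>z. (z \<cdot>\<^sub>m 1\<^sub>m N - B) $$ (k, l)) holomorphic_on S" if "k < N" "l < N" for k l
    using that B by (auto intro!: holomorphic_intros)
  have cof: "(\<lambda>z. det (mat_delete (z \<cdot>\<^sub>m 1\<^sub>m N - B) j i)) holomorphic_on S"
  proof (rule det_holomorphic[where n = "N - 1"])
    fix k l assume kl: "k < N - 1" "l < N - 1"
    show "(\<lambda>z. mat_delete (z \<cdot>\<^sub>m 1\<^sub>m N - B) j i $$ (k, l)) holomorphic_on S"
    proof -
      let ?k = "if k < j then k else Suc k" and ?l = "if l < i then l else Suc l"
      have "mat_delete (z \<cdot>\<^sub>m 1\<^sub>m N - B) j i $$ (k, l) = (z \<cdot>\<^sub>m 1\<^sub>m N - B) $$ (?k, ?l)" for z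
        using kl d by (simp add: mat_delete_def)
      moreover have "?k < N" "?l < N" using kl by auto
      ultimately show ?thesis using C[of ?k ?l] by (simp only:)
    qed
  qed (use d in \<open>auto simp: mat_delete_def\<close>)
  have eq: "resolvent B z $$ (i, j) = inverse (det (z \<cdot>\<^sub>m 1\<^sub>m N - B))
      * ((-1) ^ (j + i) * det (mat_delete (z \<cdot>\<^sub>m 1\<^sub>m N - B) j i))" for z
    using ij d unfolding resolvent_def Let_def by (simp add: adj_mat_def cofactor_def)
  have "(\<lambda>z. det (z \<cdot>\<^sub>m 1\<^sub>m N - B)) holomorphic_on S"
    using B C by (intro det_holomorphic[where n = N]) auto
  then show ?thesis unfolding eq using cof assms(2) by (intro holomorphic_intros) auto
qed

text \<open>
  The space \<open>\<complex>\<^sup>N\<close> with the inner product of a positive definite Hermitian matrix \<open>H\<close>.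
\<close>

locale weighted_space =
  fixes N :: nat and H :: "complex mat"
  assumes H: "H \<in> carrier_mat N N"
    and hermitian: "x \<in> carrier_vec N \<Longrightarrow> y \<in> carrier_vec N \<Longrightarrow> weighted_inner H y x = cnj (weighted_inner H x y)"
    and positive: "x \<in> carrier_vec N \<Longrightarrow> x \<noteq> 0\<^sub>v N \<Longrightarrow> 0 < Re (weighted_inner H x x)"
begin

lemma inner_zero [simp]: "weighted_inner H (0\<^sub>v N) (0\<^sub>v N) = 0"
  using H by (simp add: weighted_inner_sum[OF H])

lemma inner_nonneg: "x \<in> carrier_vec N \<Longrightarrow> 0 \<le> Re (weighted_inner H x x)"
  using positive[of x] by (cases "x = 0\<^sub>v N") auto

lemma inner_self: "x \<in> carrier_vec N \<Longrightarrow> weighted_inner H x x = of_real ((weighted_norm H x)\<^sup>2)"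
  using hermitian[of x x] inner_nonneg[of x] by (simp add: weighted_norm_def complex_eq_iff)

lemma norm_nonneg [simp]: "x \<in> carrier_vec N \<Longrightarrow> 0 \<le> weighted_norm H x"
  using inner_nonneg[of x] by (simp add: weighted_norm_def)

lemma norm_pos: "x \<in> carrier_vec N \<Longrightarrow> x \<noteq> 0\<^sub>v N \<Longrightarrow> 0 < weighted_norm H x"
  using positive[of x] by (simp add: weighted_norm_def)

lemma norm_zero [simp]: "weighted_norm H (0\<^sub>v N) = 0"
  by (simp add: weighted_norm_def)

lemma norm_smult: "x \<in> carrier_vec N \<Longrightarrow> weighted_norm H (c \<cdot>\<^sub>v x) = cmod c * weighted_norm H x"
proof -
  assume x: "x \<in> carrier_vec N"
  have "weighted_inner H (c \<cdot>\<^sub>v x) (c \<cdot>\<^sub>v x) = of_real ((cmod c * weighted_norm H x)\<^sup>2)"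
    unfolding weighted_inner_smult_left[OF H smult_carrier_vec[THEN iffD2, OF x] x] weighted_inner_smult_right[OF H x x] inner_self[OF x]
    by (simp only: power_mult_distrib of_real_mult complex_norm_square mult_ac)
  then have "weighted_norm H (c \<cdot>\<^sub>v x) = sqrt ((cmod c * weighted_norm H x)\<^sup>2)"
    unfolding weighted_norm_def[of H "c \<cdot>\<^sub>v x"] by (simp only: Re_complex_of_real)
  then show ?thesis using x by (simp add: real_sqrt_abs abs_mult)
qed

text \<open>
  A bound by the sum of squared norms improves to a bound by the product of norms, by homogeneity.
\<close>

lemma form_bound_scale:
  assumes M: "M \<in> carrier_mat N N" and x: "x \<in> carrier_vec N" and y: "y \<in> carrier_vec N" 
    and bd: "\<And>x y. x \<in> carrier_vec N \<Longrightarrow> y \<in> carrier_vec N \<Longrightarrow>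
       cmod (weighted_inner M x y) \<le> c * ((weighted_norm H x)\<^sup>2 + (weighted_norm H y)\<^sup>2)"
  shows "cmod (weighted_inner M x y) \<le> 2 * c * weighted_norm H x * weighted_norm H y"
proof (cases "x = 0\<^sub>v N \<or> y = 0\<^sub>v N")
  case True
  then have "weighted_inner M x y = 0" using x y by (auto simp: weighted_inner_sum[OF M])
  then show ?thesis using True x y by auto
next
  case False
  define p where "p = weighted_norm H x"
  define q where "q = weighted_norm H y"
  have pq: "0 < p" "0 < q" using False norm_pos x y by (auto simp: p_def q_def)
  have n: "weighted_norm H (of_real (1 / p) \<cdot>\<^sub>v x) = 1" "weighted_norm H (of_real (1 / q) \<cdot>\<^sub>v y) = 1"
    unfolding norm_smult[OF x] norm_smult[OF y] p_def[symmetric] q_def[symmetric] using pq by (simp_all add: norm_divide)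
  have "cmod (weighted_inner M (of_real (1 / p) \<cdot>\<^sub>v x) (of_real (1 / q) \<cdot>\<^sub>v y)) \<le> 2 * c"
    using bd[of "of_real (1 / p) \<cdot>\<^sub>v x" "of_real (1 / q) \<cdot>\<^sub>v y"] x y unfolding n by simp
  moreover have "weighted_inner M (of_real (1 / p) \<cdot>\<^sub>v x) (of_real (1 / q) \<cdot>\<^sub>v y) = weighted_inner M x y / (p * q)"
    using x y by (simp add: weighted_inner_linear[OF M])
  ultimately have "cmod (weighted_inner M x y / (p * q)) \<le> 2 * c" by (simp only:)
  then show ?thesis using pq
    by (simp add: norm_divide norm_mult p_def[symmetric] q_def[symmetric] field_simps)
qed

lemma Cauchy_Schwarz:
  assumes x: "x \<in> carrier_vec N" and y: "y \<in> carrier_vec N"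
  shows "cmod (weighted_inner H x y) \<le> weighted_norm H x * weighted_norm H y"
proof -
  have "cmod (weighted_inner H x y) \<le> 2 * (1/2) * weighted_norm H x * weighted_norm H y"
  proof (rule form_bound_scale[OF H x y])
    fix x y :: "complex vec" assume xy: "x \<in> carrier_vec N" "y \<in> carrier_vec N"
    have "cmod (2 * weighted_inner H x y) \<le> (weighted_norm H x)\<^sup>2 + (weighted_norm H y)\<^sup>2"
      using weighted_inner_polarization[OF H xy inner_nonneg] hermitian[OF xy] xy
      by (simp add: inner_self del: of_real_power)
    then show "cmod (weighted_inner H x y) \<le> 1/2 * ((weighted_norm H x)\<^sup>2 + (weighted_norm H y)\<^sup>2)"
      by (simp add: norm_mult)
  qed
  then show ?thesis by simp
qed

text \<open>
  The operator norm is at most twice the numerical radius, by the four-term polarization identity.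
\<close>

lemma norm_le_numerical_bound:
  assumes B: "B \<in> carrier_mat N N" and r: "0 \<le> r"
    and rad: "\<And>x. x \<in> carrier_vec N \<Longrightarrow> cmod (weighted_inner H x (B *\<^sub>v x)) \<le> r * (weighted_norm H x)\<^sup>2"
    and x: "x \<in> carrier_vec N"
  shows "weighted_norm H (B *\<^sub>v x) \<le> 2 * r * weighted_norm H x"
proof -
  have M: "H * B \<in> carrier_mat N N" using H B by auto
  have rad': "cmod (weighted_inner (H * B) x x) \<le> r * Re (weighted_inner H x x)" if "x \<in> carrier_vec N" for x
    using rad[OF that] that H B by (simp add: weighted_inner_mult[OF H] inner_self del: of_real_power)
  have bd: "cmod (weighted_inner (H * B) x y) \<le> r * ((weighted_norm H x)\<^sup>2 + (weighted_norm H y)\<^sup>2)"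
    if x: "x \<in> carrier_vec N" and y: "y \<in> carrier_vec N" for x y
  proof -
    define Q where "Q c = weighted_inner (H * B) (x + c \<cdot>\<^sub>v y) (x + c \<cdot>\<^sub>v y)" for c
    define S where "S c = weighted_inner H (x + c \<cdot>\<^sub>v y) (x + c \<cdot>\<^sub>v y)" for c
    have Q: "Q c = weighted_inner (H * B) x x + c * weighted_inner (H * B) x y
       + cnj c * weighted_inner (H * B) y x + cnj c * c * weighted_inner (H * B) y y" for c
      using x y unfolding Q_def by (simp add: weighted_inner_linear[OF M] algebra_simps)
    have S: "S c = weighted_inner H x x + c * weighted_inner H x y
       + cnj c * weighted_inner H y x + cnj c * c * weighted_inner H y y" for c
      using x y unfolding S_def by (simp add: weighted_inner_linear[OF H] algebra_simps)
    have QS: "cmod (Q c) \<le> r * Re (S c)" for c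
      unfolding Q_def S_def using x y by (intro rad') auto
    have "4 * weighted_inner (H * B) x y = Q 1 - Q (-1) - \<i> * Q \<i> + \<i> * Q (- \<i>)"
      unfolding Q by (simp add: algebra_simps)
    then have "4 * cmod (weighted_inner (H * B) x y) = cmod (Q 1 - Q (-1) - \<i> * Q \<i> + \<i> * Q (- \<i>))"
      by (metis norm_mult norm_numeral)
    also have "\<dots> \<le> cmod (Q 1) + cmod (Q (-1)) + cmod (\<i> * Q \<i>) + cmod (\<i> * Q (- \<i>))"
      using norm_triangle_ineq[of "Q 1 - Q (-1) - \<i> * Q \<i>" "\<i> * Q (- \<i>)"]
        norm_triangle_ineq4[of "Q 1 - Q (-1)" "\<i> * Q \<i>"] norm_triangle_ineq4[of "Q 1" "Q (-1)"] by linarith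
    also have "\<dots> \<le> r * Re (S 1) + r * Re (S (-1)) + r * Re (S \<i>) + r * Re (S (-\<i>))"
      using QS[of 1] QS[of "-1"] QS[of \<i>] QS[of "-\<i>"] by (simp add: norm_mult)
    also have "\<dots> = 4 * (r * ((weighted_norm H x)\<^sup>2 + (weighted_norm H y)\<^sup>2))"
      unfolding S using x y by (simp add: inner_self algebra_simps del: of_real_power)
    finally show ?thesis by simp
  qed
  let ?w = "B *\<^sub>v x"
  have w: "?w \<in> carrier_vec N" using B x by auto
  have "(weighted_norm H ?w)\<^sup>2 = cmod (weighted_inner (H * B) ?w x)"
    using inner_self[OF w] norm_nonneg[OF w] by (simp add: weighted_inner_mult[OF H B x] norm_power)
  also have "\<dots> \<le> 2 * r * weighted_norm H ?w * weighted_norm H x"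
    by (rule form_bound_scale[OF M w x bd])
  finally have "weighted_norm H ?w * weighted_norm H ?w \<le> (2 * r * weighted_norm H x) * weighted_norm H ?w"
    by (simp add: power2_eq_square mult_ac)
  then show ?thesis
    using norm_nonneg[OF w] r norm_nonneg[OF x] by (cases "weighted_norm H ?w = 0") auto
qed

end

section \<open>Powers of polynomials of a dissipative matrix\<close>

lemma weighted_inner_mat_poly:
  assumes M: "M \<in> carrier_mat N N" and A: "A \<in> carrier_mat N N" and y: "y \<in> carrier_vec N" and x: "x \<in> carrier_vec N"
  shows "weighted_inner M y (mat_poly q A *\<^sub>v x)
    = (\<Sum>k\<le>Polynomial.degree q. Polynomial.coeff q k * weighted_inner M y ((A ^\<^sub>m k) *\<^sub>v x))"
proof -
  have Ak: "A ^\<^sub>m k \<in> carrier_mat N N" for k using A by simp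
  have P: "mat_poly q A \<in> carrier_mat N N" using A by (simp add: mat_poly_def)
  have entry: "(mat_poly q A *\<^sub>v x) $ j = (\<Sum>k\<le>Polynomial.degree q. Polynomial.coeff q k * ((A ^\<^sub>m k) *\<^sub>v x) $ j)"
    if "j < N" for j
  proof -
    have "(mat_poly q A *\<^sub>v x) $ j
        = (\<Sum>i<N. \<Sum>k\<le>Polynomial.degree q. Polynomial.coeff q k * (A ^\<^sub>m k) $$ (j, i) * x $ i)"
      using that x A P by (simp add: scalar_prod_def mat_poly_def atLeast0LessThan sum_distrib_right)
    also have "\<dots> = (\<Sum>k\<le>Polynomial.degree q. Polynomial.coeff q k * (\<Sum>i<N. (A ^\<^sub>m k) $$ (j, i) * x $ i))"
      by (subst sum.swap) (simp add: sum_distrib_left mult.assoc)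
    also have "\<dots> = (\<Sum>k\<le>Polynomial.degree q. Polynomial.coeff q k * ((A ^\<^sub>m k) *\<^sub>v x) $ j)"
    proof (rule sum.cong[OF refl])
      fix k
      have "((A ^\<^sub>m k) *\<^sub>v x) $ j = (\<Sum>i<N. (A ^\<^sub>m k) $$ (j, i) * x $ i)"
        using that x carrier_matD[OF Ak[of k]] by (simp add: scalar_prod_def atLeast0LessThan)
      then show "Polynomial.coeff q k * (\<Sum>i<N. (A ^\<^sub>m k) $$ (j, i) * x $ i) = Polynomial.coeff q k * ((A ^\<^sub>m k) *\<^sub>v x) $ j"
        by simp
    qed
    finally show ?thesis .
  qed
  have "weighted_inner M y (mat_poly q A *\<^sub>v x)
     = (\<Sum>i<N. \<Sum>j<N. \<Sum>k\<le>Polynomial.degree q. Polynomial.coeff q k * (cnj (y $ i) * M $$ (i, j) * ((A ^\<^sub>m k) *\<^sub>v x) $ j))"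
    using x y P by (subst weighted_inner_sum[OF M])
      (auto simp: entry sum_distrib_left mult_ac simp del: index_mult_mat_vec intro!: sum.cong)
  also have "\<dots> = (\<Sum>k\<le>Polynomial.degree q. Polynomial.coeff q k * (\<Sum>i<N. \<Sum>j<N. cnj (y $ i) * M $$ (i, j) * ((A ^\<^sub>m k) *\<^sub>v x) $ j))"
    by (simp add: sum_distrib_left sum.swap[of _ "{..<N}" "{..Polynomial.degree q}"])
  also have "\<dots> = (\<Sum>k\<le>Polynomial.degree q. Polynomial.coeff q k * weighted_inner M y ((A ^\<^sub>m k) *\<^sub>v x))"
    using x y Ak by (simp add: weighted_inner_sum[OF M y mult_mat_vec_carrier[OF Ak x]])
  finally show ?thesis .
qed

text \<open>
  A matrix \<open>B\<close> whose numerical range lies in the half plane \<open>Re z \<le> - \<delta>\<close> and in the disc of radius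
  \<open>r\<close>. Strict dissipativity keeps the spectrum away from the imaginary axis.
\<close>

locale dissipative_matrix = weighted_space +
  fixes B :: "complex mat" and r \<delta> :: real
  assumes B: "B \<in> carrier_mat N N" and \<delta>: "0 < \<delta>" and r: "0 \<le> r"
    and dissipative: "x \<in> carrier_vec N \<Longrightarrow> Re (weighted_inner H x (B *\<^sub>v x)) \<le> - \<delta> * (weighted_norm H x)\<^sup>2"
    and radius: "x \<in> carrier_vec N \<Longrightarrow> cmod (weighted_inner H x (B *\<^sub>v x)) \<le> r * (weighted_norm H x)\<^sup>2"
begin

text \<open>
  The complement of the convex set that is known to contain the numerical range; the resolvent is
  holomorphic there.
\<close>

definition \<Omega> :: "complex set" where "\<Omega> = {z. - \<delta> < Re z \<or> r < cmod z}"

text \<open>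
  The sesquilinear form \<open>\<langle>y, (z - B)\<^sup>-\<^sup>1 x\<rangle>\<close> of the resolvent in the weighted inner product.
\<close>

definition G :: "complex vec \<Rightarrow> complex vec \<Rightarrow> complex \<Rightarrow> complex" where
  "G y x z = weighted_inner (H * resolvent B z) y x"

lemma det_nonzero:
  assumes "z \<in> \<Omega>"
  shows "det (z \<cdot>\<^sub>m 1\<^sub>m N - B) \<noteq> 0"
proof
  have C: "z \<cdot>\<^sub>m 1\<^sub>m N - B \<in> carrier_mat N N" using B by (intro minus_carrier_mat) auto
  assume "det (z \<cdot>\<^sub>m 1\<^sub>m N - B) = 0"
  then obtain v where v: "v \<in> carrier_vec N" "v \<noteq> 0\<^sub>v N" "(z \<cdot>\<^sub>m 1\<^sub>m N - B) *\<^sub>v v = 0\<^sub>v N"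
    using det_0_iff_vec_prod_zero_field[OF C] by blast
  have Bv: "B *\<^sub>v v \<in> carrier_vec N" using B v by auto
  have move: "a = b" if "a - b = 0\<^sub>v N" "a \<in> carrier_vec N" "b \<in> carrier_vec N" for a b :: "complex vec"
    using that by (auto simp: vec_eq_iff)
  have "z \<cdot>\<^sub>v v = B *\<^sub>v v"
    by (rule move[OF _ _ Bv]) (use v(1,3) Bv in \<open>auto simp: char_matrix_apply[OF B]\<close>)
  then have e: "weighted_inner H v (B *\<^sub>v v) = z * of_real ((weighted_norm H v)\<^sup>2)"
    using v weighted_inner_smult_right[OF H v(1) v(1), of z] inner_self[OF v(1)] by simp
  have X: "0 < (weighted_norm H v)\<^sup>2" using norm_pos[OF v(1,2)] by simp
  have "Re z * (weighted_norm H v)\<^sup>2 \<le> - \<delta> * (weighted_norm H v)\<^sup>2"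
    using dissipative[OF v(1)] unfolding e by simp
  then have "Re z \<le> - \<delta>" using X by (simp only: mult_le_cancel_right_pos)
  have "cmod z * (weighted_norm H v)\<^sup>2 \<le> r * (weighted_norm H v)\<^sup>2"
    using radius[OF v(1)] unfolding e by (simp add: norm_mult norm_power)
  then have "cmod z \<le> r" using X by (simp only: mult_le_cancel_right_pos)
  with \<open>Re z \<le> - \<delta>\<close> assms show False by (auto simp: \<Omega>_def)
qed

lemma resolvent_vec: "x \<in> carrier_vec N \<Longrightarrow> resolvent B z *\<^sub>v x \<in> carrier_vec N"
  using B by (intro mult_mat_vec_carrier[of _ N N]) auto

lemma G_eq: "x \<in> carrier_vec N \<Longrightarrow> G y x z = weighted_inner H y (resolvent B z *\<^sub>v x)"
  unfolding G_def using B by (intro weighted_inner_mult[OF H]) auto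

lemma G_holomorphic:
  assumes x: "x \<in> carrier_vec N" and y: "y \<in> carrier_vec N"
  shows "G y x holomorphic_on \<Omega>"
proof -
  have R: "resolvent B z \<in> carrier_mat N N" for z using B by simp
  have eq: "G y x = (\<lambda>z. \<Sum>i<N. \<Sum>j<N. cnj (y $ i) * (\<Sum>k<N. H $$ (i, k) * resolvent B z $$ (k, j)) * x $ j)"
  proof
    fix z
    have "H * resolvent B z \<in> carrier_mat N N" using H R by (rule mult_carrier_mat)
    then show "G y x z = (\<Sum>i<N. \<Sum>j<N. cnj (y $ i) * (\<Sum>k<N. H $$ (i, k) * resolvent B z $$ (k, j)) * x $ j)"
      unfolding G_def using x y H R[of z]
      by (subst weighted_inner_sum) (auto simp: scalar_prod_def atLeast0LessThan intro!: sum.cong)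
  qed
  show ?thesis unfolding eq
    by (intro holomorphic_on_sum holomorphic_on_mult holomorphic_on_const resolvent_holomorphic[OF B] det_nonzero) auto
qed

lemma G_shift:
  assumes z: "z \<in> \<Omega>" and x: "x \<in> carrier_vec N" and y: "y \<in> carrier_vec N"
  shows "z * G y x z = weighted_inner H y x + G y (B *\<^sub>v x) z"
proof -
  have Bx: "B *\<^sub>v x \<in> carrier_vec N" using B x by auto
  have "z * G y x z = weighted_inner H y (z \<cdot>\<^sub>v (resolvent B z *\<^sub>v x))"
    unfolding G_eq[OF x] using weighted_inner_smult_right[OF H y resolvent_vec[OF x]] by simp
  also have "\<dots> = weighted_inner H y x + G y (B *\<^sub>v x) z"
    unfolding G_eq[OF Bx] resolvent_apply(2)[OF B det_nonzero[OF z] x]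
    by (rule weighted_inner_add_right[OF H y x resolvent_vec[OF Bx]])
  finally show ?thesis .
qed

lemma resolvent_energy:
  assumes z: "z \<in> \<Omega>" and x: "x \<in> carrier_vec N" and w: "w = resolvent B z *\<^sub>v x"
  shows "z * of_real ((weighted_norm H w)\<^sup>2) = weighted_inner H w x + weighted_inner H w (B *\<^sub>v w)"
proof -
  have wc: "w \<in> carrier_vec N" unfolding w by (rule resolvent_vec[OF x])
  have Bw: "B *\<^sub>v w \<in> carrier_vec N" using B wc by auto
  have "z * of_real ((weighted_norm H w)\<^sup>2) = weighted_inner H w (z \<cdot>\<^sub>v w)"
    using weighted_inner_smult_right[OF H wc wc] inner_self[OF wc] by simp
  also have "z \<cdot>\<^sub>v w = x + B *\<^sub>v w"
    unfolding w by (rule resolvent_apply(1)[OF B det_nonzero[OF z] x])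
  finally show ?thesis using weighted_inner_add_right[OF H wc x Bw] by simp
qed

lemma G_bound:
  assumes z: "r < cmod z" and x: "x \<in> carrier_vec N" and y: "y \<in> carrier_vec N"
  shows "cmod (G y x z) \<le> weighted_norm H y * weighted_norm H x / (cmod z - r)"
proof -
  have z': "z \<in> \<Omega>" using z by (simp add: \<Omega>_def)
  define w where "w = resolvent B z *\<^sub>v x"
  have w: "w \<in> carrier_vec N" unfolding w_def by (rule resolvent_vec[OF x])
  have "cmod z * (weighted_norm H w)\<^sup>2 = cmod (z * of_real ((weighted_norm H w)\<^sup>2))"
    by (simp add: norm_mult norm_power)
  also have "\<dots> \<le> cmod (weighted_inner H w x) + cmod (weighted_inner H w (B *\<^sub>v w))"
    unfolding resolvent_energy[OF z' x w_def] by (rule norm_triangle_ineq)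
  also have "\<dots> \<le> weighted_norm H w * weighted_norm H x + r * (weighted_norm H w)\<^sup>2"
    by (intro add_mono Cauchy_Schwarz radius w x)
  finally have "((cmod z - r) * weighted_norm H w) * weighted_norm H w \<le> weighted_norm H x * weighted_norm H w"
    by (simp add: algebra_simps power2_eq_square)
  then have "(cmod z - r) * weighted_norm H w \<le> weighted_norm H x"
    using norm_nonneg[OF w] norm_nonneg[OF x] by (cases "weighted_norm H w = 0") auto
  then have wn: "weighted_norm H w \<le> weighted_norm H x / (cmod z - r)"
    using z by (simp add: field_simps)
  have "cmod (G y x z) \<le> weighted_norm H y * weighted_norm H w"
    unfolding G_eq[OF x] w_def[symmetric] by (rule Cauchy_Schwarz[OF y w])
  also have "\<dots> \<le> weighted_norm H y * (weighted_norm H x / (cmod z - r))"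
    using wn norm_nonneg[OF y] by (rule mult_left_mono)
  finally show ?thesis by simp
qed

text \<open>
  The Hermitian part of the resolvent is a positive form on the closed right half plane: the
  operator version of the positivity of the Poisson kernel. Positivity bounds its off-diagonal
  values by its diagonal ones.
\<close>

lemma G_Poisson:
  assumes z: "0 \<le> Re z" and x: "x \<in> carrier_vec N" and y: "y \<in> carrier_vec N"
  shows "cmod (G y x z + cnj (G x y z)) \<le> Re (G x x z + G y y z)"
proof -
  have z': "z \<in> \<Omega>" using z \<delta> by (auto simp: \<Omega>_def)
  have M: "H * resolvent B z \<in> carrier_mat N N" using H B by auto
  have nonneg: "0 \<le> Re (weighted_inner (H * resolvent B z) v v)" if v: "v \<in> carrier_vec N" for v
  proof -
    define w where "w = resolvent B z *\<^sub>v v"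
    have w: "w \<in> carrier_vec N" unfolding w_def by (rule resolvent_vec[OF v])
    have "Re z * (weighted_norm H w)\<^sup>2 = Re (weighted_inner H w v) + Re (weighted_inner H w (B *\<^sub>v w))"
      using arg_cong[OF resolvent_energy[OF z' v w_def], of Re] by (simp del: of_real_power)
    moreover have "0 \<le> Re z * (weighted_norm H w)\<^sup>2" using z by simp
    moreover have "0 \<le> \<delta> * (weighted_norm H w)\<^sup>2" using \<delta> by simp
    ultimately have "0 \<le> Re (weighted_inner H w v)" using dissipative[OF w] by linarith
    then show ?thesis
      using hermitian[OF v w] G_eq[OF v, of v z] by (simp add: G_def w_def)
  qed
  show ?thesis using weighted_inner_polarization[OF M y x nonneg] by (simp add: G_def add.commute)
qed

context
  fixes \<rho> :: real assumes \<rho>: "2 * r < \<rho>"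
begin

lemma \<rho>_pos: "0 < \<rho>" "r < \<rho>" using \<rho> r by auto

lemma sphere_\<Omega>: "sphere 0 \<rho> \<subseteq> \<Omega>" using \<rho>_pos by (auto simp: \<Omega>_def)

text \<open>
  The Dunford integral \<open>\<integral> f z \<langle>y, (z - B)\<^sup>-\<^sup>1 x\<rangle> dz\<close> over the circle of radius \<open>\<rho>\<close>; for polynomials
  \<open>f\<close> it equals \<open>2 \<pi> \<i> \<langle>y, f B x\<rangle>\<close>.
\<close>

definition J :: "(complex \<Rightarrow> complex) \<Rightarrow> complex vec \<Rightarrow> complex vec \<Rightarrow> complex" where
  "J f y x = contour_integral (full_circle \<rho>) (\<lambda>z. f z * G y x z)"

lemma G_continuous:
  assumes "x \<in> carrier_vec N" "y \<in> carrier_vec N"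
  shows "continuous_on (sphere 0 \<rho>) (G y x)"
  by (rule continuous_on_subset[OF holomorphic_on_imp_continuous_on[OF G_holomorphic[OF assms]] sphere_\<Omega>])

lemma J_integrable:
  assumes "x \<in> carrier_vec N" "y \<in> carrier_vec N" "continuous_on (sphere 0 \<rho>) f"
  shows "(\<lambda>z. f z * G y x z) contour_integrable_on full_circle \<rho>"
  using G_continuous[OF assms(1,2)] assms(3) \<rho>_pos
  by (intro contour_integrable_on_circle_arc continuous_intros) auto

lemma circle_image: "z \<in> path_image (full_circle \<rho>) \<Longrightarrow> cmod z = \<rho>"
  using path_image_part_circlepath_subset'[of \<rho> 0 "- (pi / 2)" "3 * pi / 2"] \<rho>_pos by auto

lemma J_times_id:
  assumes x: "x \<in> carrier_vec N" and y: "y \<in> carrier_vec N" and f: "f holomorphic_on UNIV"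
  shows "J (\<lambda>z. z * f z) y x = J f y (B *\<^sub>v x)"
proof -
  have Bx: "B *\<^sub>v x \<in> carrier_vec N" using B x by auto
  have cf: "continuous_on (sphere 0 \<rho>) f"
    using holomorphic_on_imp_continuous_on[OF f] by (rule continuous_on_subset) auto
  have "J (\<lambda>z. z * f z) y x = contour_integral (full_circle \<rho>) (\<lambda>z. f z * weighted_inner H y x + f z * G y (B *\<^sub>v x) z)"
    unfolding J_def
  proof (rule contour_integral_cong[OF refl])
    fix z assume "z \<in> path_image (full_circle \<rho>)"
    then have "z \<in> \<Omega>" using sphere_\<Omega> circle_image by auto
    have "z * f z * G y x z = f z * (z * G y x z)" by simp
    then show "z * f z * G y x z = f z * weighted_inner H y x + f z * G y (B *\<^sub>v x) z"
      unfolding G_shift[OF \<open>z \<in> \<Omega>\<close> x y] by (simp only: distrib_left)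
  qed
  also have "\<dots> = contour_integral (full_circle \<rho>) (\<lambda>z. f z * weighted_inner H y x) + J f y (B *\<^sub>v x)"
    unfolding J_def using cf \<rho>_pos
    by (intro contour_integral_add J_integrable[OF Bx y cf] contour_integrable_on_circle_arc continuous_intros) auto
  also have "contour_integral (full_circle \<rho>) (\<lambda>z. f z * weighted_inner H y x) = 0"
    using f by (intro contour_integral_full_circle_entire holomorphic_intros)
  finally show ?thesis by simp
qed

text \<open>
  Iterating the resolvent identity gives the Neumann expansion of the resolvent on the circle. Only
  its first term has a nonzero integral, and the remainder after \<open>k\<close> steps is of order
  \<open>(2 r / \<rho>)\<^sup>k\<close> because the norm of \<open>B\<close> is at most \<open>2 r\<close>.
\<close>

lemma J_one:
  assumes x: "x \<in> carrier_vec N" and y: "y \<in> carrier_vec N"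
  shows "J (\<lambda>_. 1) y x = 2 * pi * \<i> * weighted_inner H y x"
proof -
  define v where "v k = ((\<lambda>w. B *\<^sub>v w) ^^ k) x" for k
  have v: "v k \<in> carrier_vec N" for k unfolding v_def using x B by (induction k) auto
  have cp: "continuous_on (sphere 0 \<rho>) (\<lambda>z::complex. 1 / z ^ k)" for k
    using \<rho>_pos by (intro continuous_intros) auto
  have step: "J (\<lambda>z. 1 / z ^ k) y (v k)
     = (if k = 0 then 2 * pi * \<i> * weighted_inner H y x else 0) + J (\<lambda>z. 1 / z ^ Suc k) y (v (Suc k))" for k
  proof -
    have "J (\<lambda>z. 1 / z ^ k) y (v k)
       = contour_integral (full_circle \<rho>) (\<lambda>z. (1 / z ^ Suc k) * weighted_inner H y (v k) + (1 / z ^ Suc k) * G y (v (Suc k)) z)"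
      unfolding J_def
    proof (rule contour_integral_cong[OF refl])
      fix z assume z: "z \<in> path_image (full_circle \<rho>)"
      then have "z \<in> \<Omega>" using sphere_\<Omega> circle_image by auto
      from G_shift[OF this v y, of k]
      have e: "z * G y (v k) z = weighted_inner H y (v k) + G y (v (Suc k)) z" by (simp add: v_def)
      have "z \<noteq> 0" using circle_image[OF z] \<rho>_pos by auto
      then have "1 / z ^ k * G y (v k) z = (1 / z ^ Suc k) * (z * G y (v k) z)" by simp
      then show "1 / z ^ k * G y (v k) z = (1 / z ^ Suc k) * weighted_inner H y (v k) + (1 / z ^ Suc k) * G y (v (Suc k)) z"
        unfolding e by (simp only: distrib_left)
    qed
    also have "\<dots> = contour_integral (full_circle \<rho>) (\<lambda>z. (1 / z ^ Suc k) * weighted_inner H y (v k)) + J (\<lambda>z. 1 / z ^ Suc k) y (v (Suc k))"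
      unfolding J_def using cp[of "Suc k"] \<rho>_pos
      by (intro contour_integral_add J_integrable[OF v y cp] contour_integrable_on_circle_arc continuous_on_mult continuous_on_const) auto
    also have "contour_integral (full_circle \<rho>) (\<lambda>z. (1 / z ^ Suc k) * weighted_inner H y (v k))
      = contour_integral (full_circle \<rho>) (\<lambda>z. 1 / z ^ Suc k) * weighted_inner H y (v k)"
      using cp[of "Suc k"] \<rho>_pos by (intro contour_integral_rmul contour_integrable_on_circle_arc) auto
    also have "\<dots> = (if k = 0 then 2 * pi * \<i> * weighted_inner H y x else 0)"
      unfolding contour_integral_full_circle_inverse_power[OF \<rho>_pos(1)] by (simp add: v_def)
    finally show ?thesis .
  qed
  have tail: "J (\<lambda>_. 1) y x - 2 * pi * \<i> * weighted_inner H y x = J (\<lambda>z. 1 / z ^ Suc k) y (v (Suc k))" for k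
  proof (induction k)
    case 0 show ?case using step[of 0] by (simp add: v_def)
  next
    case (Suc k) then show ?case using step[of "Suc k"] by simp
  qed
  define E where "E = 2 * pi * \<rho> * (weighted_norm H y * weighted_norm H x / (\<rho> - r))"
  have vn: "weighted_norm H (v k) \<le> (2 * r) ^ k * weighted_norm H x" for k
  proof (induction k)
    case 0 show ?case by (simp add: v_def)
  next
    case (Suc k)
    have "weighted_norm H (v (Suc k)) \<le> 2 * r * weighted_norm H (v k)"
      using norm_le_numerical_bound[OF B r radius v[of k]] by (simp add: v_def)
    also have "\<dots> \<le> 2 * r * ((2 * r) ^ k * weighted_norm H x)"
      using Suc r by (intro mult_left_mono) auto
    finally show ?case by (simp add: mult_ac)
  qed
  have "cmod (J (\<lambda>_. 1) y x - 2 * pi * \<i> * weighted_inner H y x) \<le> E * (2 * r / \<rho>) ^ Suc k" for k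
  proof -
    have "cmod (J (\<lambda>z. 1 / z ^ Suc k) y (v (Suc k)))
      \<le> ((1 / \<rho> ^ Suc k) * (weighted_norm H y * ((2 * r) ^ Suc k * weighted_norm H x) / (\<rho> - r))) * \<rho> * \<bar>3 * pi / 2 - - (pi / 2)\<bar>"
      unfolding J_def
    proof (rule contour_integral_bound_part_circlepath[OF J_integrable[OF v y cp]])
      fix z assume "z \<in> path_image (full_circle \<rho>)"
      then have z: "cmod z = \<rho>" by (rule circle_image)
      have "cmod (G y (v (Suc k)) z) \<le> weighted_norm H y * weighted_norm H (v (Suc k)) / (\<rho> - r)"
        using G_bound[OF _ v y, of z "Suc k"] z \<rho>_pos by simp
      also have "\<dots> \<le> weighted_norm H y * ((2 * r) ^ Suc k * weighted_norm H x) / (\<rho> - r)"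
        using vn[of "Suc k"] norm_nonneg[OF y] \<rho>_pos by (intro divide_right_mono mult_left_mono) auto
      finally show "cmod (1 / z ^ Suc k * G y (v (Suc k)) z)
         \<le> (1 / \<rho> ^ Suc k) * (weighted_norm H y * ((2 * r) ^ Suc k * weighted_norm H x) / (\<rho> - r))"
        unfolding norm_mult norm_divide norm_power z norm_one using \<rho>_pos by (intro mult_left_mono) auto
    qed (use \<rho>_pos r norm_nonneg[OF x] norm_nonneg[OF y] in auto)
    also have "\<dots> = E * (2 * r / \<rho>) ^ Suc k"
      by (simp add: E_def power_divide field_simps)
    finally show ?thesis unfolding tail[of k] .
  qed
  moreover have "(\<lambda>k. E * (2 * r / \<rho>) ^ Suc k) \<longlonglongrightarrow> E * 0"
    using \<rho> r \<rho>_pos by (intro tendsto_mult tendsto_const LIMSEQ_Suc[OF LIMSEQ_power_zero]) auto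
  ultimately have "cmod (J (\<lambda>_. 1) y x - 2 * pi * \<i> * weighted_inner H y x) \<le> E * 0"
    by (intro LIMSEQ_le_const) auto
  then show ?thesis by simp
qed

lemma J_linear_combination:
  assumes f: "\<And>k. k \<in> S \<Longrightarrow> f k holomorphic_on UNIV" "finite S"
    and "x \<in> carrier_vec N" "y \<in> carrier_vec N"
  shows "J (\<lambda>z. \<Sum>k\<in>S. c k * f k z) y x = (\<Sum>k\<in>S. c k * J (f k) y x)"
proof -
  have i: "(\<lambda>z. f k z * G y x z) contour_integrable_on full_circle \<rho>" if "k \<in> S" for k
    using holomorphic_on_imp_continuous_on[OF f(1)[OF that]]
    by (intro J_integrable assms) (auto intro: continuous_on_subset)
  have "J (\<lambda>z. \<Sum>k\<in>S. c k * f k z) y x = contour_integral (full_circle \<rho>) (\<lambda>z. \<Sum>k\<in>S. c k * (f k z * G y x z))"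
    unfolding J_def by (simp add: sum_distrib_right mult.assoc)
  also have "\<dots> = (\<Sum>k\<in>S. c k * J (f k) y x)"
    unfolding J_def using i f(2) by (subst contour_integral_sum) (auto intro!: contour_integrable_lmul contour_integral_lmul sum.cong)
  finally show ?thesis .
qed

text \<open>
  Multiplying the integrand by \<open>q (z + \<delta>)\<close> amounts to applying \<open>q A\<close> to the vector, where
  \<open>A = B + \<delta>\<close>.
\<close>

lemma J_poly_shift:
  assumes x: "x \<in> carrier_vec N" and y: "y \<in> carrier_vec N" and f: "f holomorphic_on UNIV"
    and A: "A \<in> carrier_mat N N" and AB: "\<And>v. v \<in> carrier_vec N \<Longrightarrow> A *\<^sub>v v = B *\<^sub>v v + of_real \<delta> \<cdot>\<^sub>v v"
  shows "J (\<lambda>z. poly q (z + of_real \<delta>) * f z) y x = J f y (mat_poly q A *\<^sub>v x)"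
proof -
  have cf: "continuous_on (sphere 0 \<rho>) g" if "g holomorphic_on UNIV" for g
    using holomorphic_on_imp_continuous_on[OF that] by (rule continuous_on_subset) auto
  have add: "J g y (v + c \<cdot>\<^sub>v w) = J g y v + c * J g y w"
    if g: "g holomorphic_on UNIV" and v: "v \<in> carrier_vec N" and w: "w \<in> carrier_vec N" for g c v w
  proof -
    have GM: "H * resolvent B z \<in> carrier_mat N N" for z using H B by auto
    have "J g y (v + c \<cdot>\<^sub>v w) = contour_integral (full_circle \<rho>) (\<lambda>z. g z * G y v z + c * (g z * G y w z))"
      unfolding J_def G_def using v w y by (simp add: weighted_inner_linear[OF GM] algebra_simps)
    also have "\<dots> = J g y v + c * J g y w"
      unfolding J_def using J_integrable[OF v y cf[OF g]] J_integrable[OF w y cf[OF g]]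
      by (simp add: contour_integral_add contour_integrable_lmul contour_integral_lmul)
    finally show ?thesis .
  qed
  have one: "J (\<lambda>z. (z + of_real \<delta>) * g z) y v = J g y (A *\<^sub>v v)"
    if g: "g holomorphic_on UNIV" and v: "v \<in> carrier_vec N" for g v
  proof -
    have Bv: "B *\<^sub>v v \<in> carrier_vec N" using B v by auto
    have zg: "(\<lambda>z. z * g z) holomorphic_on UNIV" using g by (intro holomorphic_intros)
    have "J (\<lambda>z. (z + of_real \<delta>) * g z) y v = contour_integral (full_circle \<rho>) (\<lambda>z. z * g z * G y v z + of_real \<delta> * (g z * G y v z))"
      unfolding J_def by (simp add: algebra_simps)
    also have "\<dots> = J (\<lambda>z. z * g z) y v + of_real \<delta> * J g y v"
      unfolding J_def using J_integrable[OF v y cf[OF g]] J_integrable[OF v y cf[OF zg]]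
      by (simp add: contour_integral_add contour_integrable_lmul contour_integral_lmul)
    also have "\<dots> = J g y (A *\<^sub>v v)"
      unfolding AB[OF v] add[OF g Bv v] J_times_id[OF v y g] ..
    finally show ?thesis .
  qed
  have pw: "J (\<lambda>z. (z + of_real \<delta>) ^ k * g z) y v = J g y ((A ^\<^sub>m k) *\<^sub>v v)"
    if "g holomorphic_on UNIV" "v \<in> carrier_vec N" for k g v
    using that
  proof (induction k arbitrary: v)
    case 0 then show ?case using A by simp
  next
    case (Suc k)
    have h: "(\<lambda>z. (z + of_real \<delta>) ^ k * g z) holomorphic_on UNIV"
      using Suc.prems by (intro holomorphic_intros)
    have Av: "A *\<^sub>v v \<in> carrier_vec N" using A Suc.prems by auto
    have "J (\<lambda>z. (z + of_real \<delta>) ^ Suc k * g z) y v = J (\<lambda>z. (z + of_real \<delta>) ^ k * g z) y (A *\<^sub>v v)"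
      using one[OF h Suc.prems(2)] by (simp add: mult.assoc)
    also have "\<dots> = J g y ((A ^\<^sub>m k) *\<^sub>v (A *\<^sub>v v))" by (rule Suc.IH[OF Suc.prems(1) Av])
    also have "(A ^\<^sub>m k) *\<^sub>v (A *\<^sub>v v) = (A ^\<^sub>m Suc k) *\<^sub>v v"
      using assoc_mult_mat_vec[of "A ^\<^sub>m k" N N A N v] A Suc.prems by simp
    finally show ?case .
  qed
  let ?d = "Polynomial.degree q" and ?c = "Polynomial.coeff q"
  have hol: "(\<lambda>z. (z + of_real \<delta>) ^ k * f z) holomorphic_on UNIV" for k
    using f by (intro holomorphic_intros)
  have "J (\<lambda>z. poly q (z + of_real \<delta>) * f z) y x = J (\<lambda>z. \<Sum>k\<le>?d. ?c k * ((z + of_real \<delta>) ^ k * f z)) y x"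
    by (simp add: poly_altdef sum_distrib_right mult.assoc)
  also have "\<dots> = (\<Sum>k\<le>?d. ?c k * J f y ((A ^\<^sub>m k) *\<^sub>v x))"
    using hol by (subst J_linear_combination[OF _ _ x y]) (auto simp: pw[OF f x])
  also have "\<dots> = contour_integral (full_circle \<rho>) (\<lambda>z. \<Sum>k\<le>?d. ?c k * (f z * G y ((A ^\<^sub>m k) *\<^sub>v x) z))"
  proof -
    have Ax: "(A ^\<^sub>m k) *\<^sub>v x \<in> carrier_vec N" for k
      using A x by (intro mult_mat_vec_carrier[of _ N N]) auto
    show ?thesis unfolding J_def using J_integrable[OF Ax y cf[OF f]]
      by (subst contour_integral_sum) (auto intro!: contour_integrable_lmul contour_integral_lmul[symmetric] sum.cong)
  qed
  also have "\<dots> = J f y (mat_poly q A *\<^sub>v x)"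
  proof -
    have GM: "H * resolvent B z \<in> carrier_mat N N" for z using H B by auto
    show ?thesis unfolding J_def G_def weighted_inner_mat_poly[OF GM A y x]
      by (simp add: sum_distrib_left mult_ac)
  qed
  finally show ?thesis .
qed

text \<open>
  The power estimate: the powers of \<open>q A\<close> are bounded through the values of \<open>q\<close> on the left half
  disc of radius \<open>\<rho>\<close> shifted by \<open>\<delta>\<close>, with the factor \<open>2 \<rho> / (\<rho> - r)\<close>. The proof
  pairs \<open>u n\<close> with its multiple that has the same norm as \<open>u 0\<close>.
\<close>

lemma power_bound:
  fixes u :: "nat \<Rightarrow> complex vec"
  assumes A: "A \<in> carrier_mat N N" and AB: "\<And>v. v \<in> carrier_vec N \<Longrightarrow> A *\<^sub>v v = B *\<^sub>v v + of_real \<delta> \<cdot>\<^sub>v v"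
    and q_cnj: "\<And>z. cnj (poly q z) = poly q (cnj z)"
    and F: "\<And>z. Re z \<le> 0 \<Longrightarrow> cmod z \<le> \<rho> \<Longrightarrow> cmod (poly q (z + of_real \<delta>) ^ n) \<le> F"
    and u0: "u 0 \<in> carrier_vec N" and u: "\<And>k. u (Suc k) = mat_poly q A *\<^sub>v u k"
  shows "weighted_norm H (u n) \<le> 2 * \<rho> / (\<rho> - r) * F * weighted_norm H (u 0)"
proof -
  have P: "mat_poly q A \<in> carrier_mat N N" using A by (simp add: mat_poly_def)
  have uc: "u k \<in> carrier_vec N" for k
    using u0 P by (induction k) (auto simp: u)
  have F0: "0 \<le> F" using order.trans[OF norm_ge_zero F[of 0]] \<rho>_pos by simp
  show ?thesis
  proof (cases "u n = 0\<^sub>v N")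
    case True
    then show ?thesis using F0 \<rho>_pos norm_nonneg[OF u0] by simp
  next
    case False
    define X where "X = weighted_norm H (u 0)"
    have X0: "0 \<le> X" unfolding X_def by (rule norm_nonneg[OF u0])
    define W where "W = weighted_norm H (u n)"
    have W: "0 < W" unfolding W_def by (rule norm_pos[OF uc False])
    define y where "y = of_real (X / W) \<cdot>\<^sub>v u n"
    have y: "y \<in> carrier_vec N" using uc by (simp add: y_def)
    have yX: "weighted_norm H y = X"
      unfolding y_def norm_smult[OF uc] using W X0 by (simp add: W_def[symmetric] norm_divide)
    have yu: "weighted_inner H y (u n) = of_real (X * W)"
    proof -
      have "weighted_inner H y (u n) = of_real (X / W) * of_real (W\<^sup>2)"
        unfolding y_def weighted_inner_smult_left[OF H uc uc] inner_self[OF uc] W_def by simp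
      then show ?thesis using W by (simp add: power2_eq_square)
    qed
    have hol: "(\<lambda>z. poly q (z + of_real \<delta>) ^ m) holomorphic_on S" for m S
      unfolding poly_altdef by (intro holomorphic_intros)
    have "J (\<lambda>z. poly q (z + of_real \<delta>) ^ m) y (u k) = J (\<lambda>_. 1) y (u (k + m))" for m k
    proof (induction m arbitrary: k)
      case 0 show ?case by simp
    next
      case (Suc m)
      have "J (\<lambda>z. poly q (z + of_real \<delta>) ^ Suc m) y (u k) = J (\<lambda>z. poly q (z + of_real \<delta>) ^ m) y (u (Suc k))"
        unfolding u using J_poly_shift[OF uc y hol A AB] by simp
      then show ?case using Suc[of "Suc k"] by simp
    qed
    from this[of n 0] have "J (\<lambda>z. poly q (z + of_real \<delta>) ^ n) y (u 0) = 2 * pi * \<i> * of_real (X * W)"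
      using J_one[OF uc[of n] y] yu by simp
    then have JX: "cmod (J (\<lambda>z. poly q (z + of_real \<delta>) ^ n) y (u 0)) = 2 * pi * (X * W)"
      using X0 W by (simp add: norm_mult)
    have b: "cmod (G a b z) \<le> X * X / (\<rho> - r)" if "a = y \<or> a = u 0" "b = y \<or> b = u 0" "cmod z = \<rho>" for a b z
      using that G_bound[of z b a] \<rho>_pos yX uc[of 0] y X_def by auto
    have "cmod (J (\<lambda>z. poly q (z + of_real \<delta>) ^ n) y (u 0)) \<le> 4 * pi * \<rho> * F * (X * X / (\<rho> - r))"
      unfolding J_def
    proof (rule half_disc_contour_bound[where \<delta> = \<delta> and r = r and b = "G (u 0) y" and e = "\<lambda>z. G (u 0) (u 0) z + G y y z"])
      show "G y (u 0) holomorphic_on {z. - \<delta> < Re z \<or> r < cmod z}"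
        "G (u 0) y holomorphic_on {z. - \<delta> < Re z \<or> r < cmod z}"
        "(\<lambda>z. G (u 0) (u 0) z + G y y z) holomorphic_on {z. - \<delta> < Re z \<or> r < cmod z}"
        using G_holomorphic uc[of 0] y by (auto simp: \<Omega>_def[symmetric] intro!: holomorphic_on_add)
      show "cmod (G y (u 0) z) \<le> X * X / (\<rho> - r)" "cmod (G (u 0) y z) \<le> X * X / (\<rho> - r)" if "cmod z = \<rho>" for z
        using b that by auto
      show "cmod (G (u 0) (u 0) z + G y y z) \<le> 2 * (X * X / (\<rho> - r))" if "cmod z = \<rho>" for z
        using norm_triangle_ineq[of "G (u 0) (u 0) z" "G y y z"] b[of "u 0" "u 0" z] b[of y y z] that by simp
      show "cnj (poly q (z + of_real \<delta>) ^ n) = poly q (cnj z + of_real \<delta>) ^ n" for z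
        using q_cnj[of "z + of_real \<delta>"] by simp
      show "cmod (G y (u 0) (Complex 0 t) + cnj (G (u 0) y (Complex 0 t)))
        \<le> Re (G (u 0) (u 0) (Complex 0 t) + G y y (Complex 0 t))" for t
        by (rule G_Poisson[OF _ uc y]) simp
      show "cmod (poly q (z + of_real \<delta>) ^ n) \<le> F" if "Re z \<le> 0" "cmod z \<le> \<rho>" for z by (rule F[OF that])
      show "(\<lambda>z. poly q (z + of_real \<delta>) ^ n) holomorphic_on UNIV" by (rule hol)
    qed (use r \<rho>_pos \<delta> in auto)
    also have "4 * pi * \<rho> * F * (X * X / (\<rho> - r)) = 2 * pi * (X * (2 * \<rho> / (\<rho> - r) * F * X))" by simp
    finally have "X * W \<le> X * (2 * \<rho> / (\<rho> - r) * F * X)"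
      unfolding JX using pi_gt_zero by (subst (asm) mult_le_cancel_left_pos) auto
    show ?thesis
    proof (cases "X = 0")
      case True
      then have "u 0 = 0\<^sub>v N" using norm_pos[OF u0] by (auto simp: X_def)
      then have "u k = 0\<^sub>v N" for k using P by (induction k) (auto simp: u)
      then show ?thesis using False by simp
    next
      case False
      then have "0 < X" using X0 by simp
      then have "W \<le> 2 * \<rho> / (\<rho> - r) * F * X"
        using \<open>X * W \<le> _\<close> by (simp only: mult_le_cancel_left_pos)
      then show ?thesis by (simp only: X_def W_def)
    qed
  qed
qed

end

end

section \<open>Stability on a left half disc\<close>

text \<open>
  Since \<open>p 0 = p' 0 = 1\<close>, the function \<open>t \<mapsto> \<bar>p (t + \<i> y)\<bar>\<^sup>2\<close> is increasing near the origin. Hence the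
  bound on the imaginary interval spreads to the left.
\<close>

lemma half_disc_stability:
  fixes p :: "real poly"
  defines "q \<equiv> map_poly complex_of_real p"
  assumes c0: "Polynomial.coeff p 0 = 1" and c1: "Polynomial.coeff p 1 = 1" and R: "0 < R"
    and imag: "\<And>\<sigma>. \<sigma> \<in> {-R..R} \<Longrightarrow> cmod (poly q (\<i> * complex_of_real \<sigma>)) \<le> 1"
  obtains \<rho> where "0 < \<rho>" "\<rho> \<le> R" "\<And>z. Re z \<le> 0 \<Longrightarrow> cmod z \<le> \<rho> \<Longrightarrow> cmod (poly q z) \<le> 1"
proof -
  define \<phi> where "\<phi> z = Re (poly (pderiv q) z * cnj (poly q z))" for z
  have "\<phi> 0 = 1"
    using c0 c1 by (simp add: \<phi>_def poly_0_coeff_0 coeff_pderiv q_def coeff_map_poly)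
  moreover have "continuous_on UNIV \<phi>" unfolding \<phi>_def by (intro continuous_intros)
  then have "isCont \<phi> 0" by (simp add: continuous_on_eq_continuous_at)
  ultimately obtain d where d: "0 < d" "\<And>z. dist z 0 < d \<Longrightarrow> dist (\<phi> z) 1 < 1"
    unfolding continuous_at_eps_delta by (auto dest!: spec[of _ "1::real"])
  have pos: "0 \<le> \<phi> z" if "cmod z < d" for z
    using d(2)[of z] that by (simp add: dist_real_def)
  show thesis
  proof (rule that[of "min R (d / 2)"])
    fix z :: complex assume z: "Re z \<le> 0" "cmod z \<le> min R (d / 2)"
    define y where "y = Im z"
    define h where "h t = (cmod (poly q (Complex t y)))\<^sup>2" for t
    have der: "(h has_real_derivative 2 * \<phi> (Complex t y)) (at t)" for t
    proof -
      have "((\<lambda>t. Complex t y) has_vector_derivative 1) (at t)"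
        unfolding Complex_eq by (auto intro!: derivative_eq_intros)
      from field_vector_diff_chain_at[OF this poly_DERIV[of q]]
      have v: "((\<lambda>t. poly q (Complex t y)) has_vector_derivative poly (pderiv q) (Complex t y)) (at t)"
        by (simp add: o_def)
      have re: "((\<lambda>t. Re (poly q (Complex t y))) has_real_derivative Re (poly (pderiv q) (Complex t y))) (at t)"
        using bounded_linear.has_vector_derivative[OF bounded_linear_Re v]
        by (simp add: has_real_derivative_iff_has_vector_derivative)
      have im: "((\<lambda>t. Im (poly q (Complex t y))) has_real_derivative Im (poly (pderiv q) (Complex t y))) (at t)"
        using bounded_linear.has_vector_derivative[OF bounded_linear_Im v]
        by (simp add: has_real_derivative_iff_has_vector_derivative)
      show ?thesis unfolding h_def cmod_power2 \<phi>_def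
        by (rule derivative_eq_intros re im refl)+ (simp add: algebra_simps)
    qed
    have "h (Re z) \<le> h 0"
    proof (rule DERIV_nonneg_imp_nondecreasing[OF z(1)])
      fix t assume t: "Re z \<le> t" "t \<le> 0"
      have "t\<^sup>2 \<le> (Re z)\<^sup>2" using t by (simp add: abs_le_square_iff[symmetric])
      then have "cmod (Complex t y) \<le> cmod z" unfolding cmod_def y_def by simp
      then have "0 \<le> \<phi> (Complex t y)" using z d(1) by (intro pos) auto
      then show "\<exists>D. (h has_real_derivative D) (at t) \<and> 0 \<le> D" using der[of t] by (auto intro!: exI[of _ "2 * \<phi> (Complex t y)"])
    qed
    also have "h 0 \<le> 1"
    proof -
      have "\<bar>y\<bar> \<le> R" using abs_Im_le_cmod[of z] z(2) by (simp add: y_def)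
      then have "cmod (poly q (Complex 0 y)) \<le> 1" using imag[of y] by (simp add: Complex_eq abs_le_iff)
      then show ?thesis unfolding h_def by (simp add: power_le_one)
    qed
    finally show "cmod (poly q z) \<le> 1"
      using abs_square_le_1[of "cmod (poly q z)"] by (simp add: h_def y_def)
  qed (use R d in auto)
qed

section \<open>Real matrices and equivalent weights\<close>

lemma cmat_mat_poly:
  assumes "M \<in> carrier_mat N N"
  shows "cmat (mat_poly p M) = mat_poly (map_poly complex_of_real p) (cmat M)"
proof (rule eq_matI)
  fix i j assume "i < dim_row (mat_poly (map_poly complex_of_real p) (cmat M))"
    "j < dim_col (mat_poly (map_poly complex_of_real p) (cmat M))"
  then have ij: "i < N" "j < N" using assms by (auto simp: mat_poly_def)
  have "(cmat M ^\<^sub>m k) $$ (i, j) = complex_of_real ((M ^\<^sub>m k) $$ (i, j))" for k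
    unfolding of_real_hom.mat_hom_pow[OF assms, symmetric]
    by (rule index_map_mat(1)) (use ij carrier_matD[OF pow_carrier_mat[OF assms, of k]] in auto)
  then show "cmat (mat_poly p M) $$ (i, j) = mat_poly (map_poly complex_of_real p) (cmat M) $$ (i, j)"
    using ij assms by (simp add: mat_poly_def coeff_map_poly degree_map_poly)
qed (use assms in \<open>auto simp: mat_poly_def\<close>)

text \<open>
  The real part of a real quadratic form at a complex vector splits into the values at the real and
  imaginary parts; this carries the real matrix inequalities over to \<open>\<complex>\<^sup>N\<close>.
\<close>

lemma weighted_inner_cmat_Re:
  assumes M: "M \<in> carrier_mat N N" and x: "x \<in> carrier_vec N"
  shows "Re (weighted_inner (cmat M) x x)
    = map_vec Re x \<bullet> (M *\<^sub>v map_vec Re x) + map_vec Im x \<bullet> (M *\<^sub>v map_vec Im x)"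
proof -
  have cM: "cmat M \<in> carrier_mat N N" using M by simp
  have q: "v \<bullet> (M *\<^sub>v v) = (\<Sum>i<N. \<Sum>j<N. v $ i * M $$ (i, j) * v $ j)" if "v \<in> carrier_vec N" for v
    using that M by (auto simp: scalar_prod_def sum_distrib_left atLeast0LessThan mult.assoc intro!: sum.cong)
  have a: "map_vec Re x \<in> carrier_vec N" "map_vec Im x \<in> carrier_vec N" using x by auto
  show ?thesis
    unfolding weighted_inner_sum[OF cM x x] q[OF a(1)] q[OF a(2)] Re_sum sum.distrib[symmetric]
    using M x by (intro sum.cong refl) (auto simp: algebra_simps)
qed

lemma quad_le_imp_weighted_inner_le:
  assumes "quad_le N M M'" "M \<in> carrier_mat N N" "M' \<in> carrier_mat N N" "x \<in> carrier_vec N"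
  shows "Re (weighted_inner (cmat M) x x) \<le> Re (weighted_inner (cmat M') x x)"
  using assms unfolding weighted_inner_cmat_Re[OF assms(2,4)] weighted_inner_cmat_Re[OF assms(3,4)] quad_le_def
  by (intro add_mono) auto

lemma weighted_inner_scalar:
  assumes "x \<in> carrier_vec N"
  shows "Re (weighted_inner (cmat (c \<cdot>\<^sub>m 1\<^sub>m N)) x x) = c * (l2_norm x)\<^sup>2"
proof -
  have "(l2_norm x)\<^sup>2 = (\<Sum>i<N. (cmod (x $ i))\<^sup>2)"
    using assms by (simp add: l2_norm_def L2_set_def sum_nonneg)
  moreover have "Re (weighted_inner (cmat (c \<cdot>\<^sub>m 1\<^sub>m N)) x x)
     = (\<Sum>i<N. \<Sum>j<N. if i = j then c * (cmod (x $ i))\<^sup>2 else 0)"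
  proof -
    have M: "cmat (c \<cdot>\<^sub>m 1\<^sub>m N) \<in> carrier_mat N N" by simp
    show ?thesis
      unfolding weighted_inner_sum[OF M assms assms] Re_sum
      by (intro sum.cong refl)
        (auto simp: cmod_power2 distrib_left power2_eq_square[of "Re _"] power2_eq_square[of "Im _"] mult_ac)
  qed
  ultimately show ?thesis by (simp add: sum_distrib_left)
qed

lemma negative_imp_dissipative:
  assumes L: "L \<in> carrier_mat N N" and H: "H \<in> carrier_mat N N" and sym: "transpose_mat H = H"
    and neg: "quad_le N (transpose_mat L * H + H * L) (0\<^sub>m N N)" and x: "x \<in> carrier_vec N"
  shows "Re (weighted_inner (cmat H) x (cmat L *\<^sub>v x)) \<le> 0"
proof -
  have HL: "H * L \<in> carrier_mat N N" using H L by simp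
  have T: "transpose_mat L * H = transpose_mat (H * L)" using H L sym by (simp add: transpose_mult)
  have q: "v \<bullet> ((transpose_mat L * H + H * L) *\<^sub>v v) = 2 * (v \<bullet> ((H * L) *\<^sub>v v))" if v: "v \<in> carrier_vec N" for v
  proof -
    have "v \<bullet> (transpose_mat (H * L) *\<^sub>v v) = v \<bullet> ((H * L) *\<^sub>v v)"
      using transpose_vec_mult_scalar[OF HL v v] HL v
      by (metis mult_mat_vec_carrier comm_scalar_prod transpose_carrier_mat)
    then show ?thesis unfolding T using HL v
      by (simp add: add_mult_distrib_mat_vec[of _ N N] scalar_prod_add_distrib[of _ N] del: assoc_mult_mat_vec)
  qed
  have n: "v \<bullet> ((H * L) *\<^sub>v v) \<le> 0" if v: "v \<in> carrier_vec N" for v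
  proof -
    have "v \<bullet> (0\<^sub>m N N *\<^sub>v v) = 0" using v by (simp add: scalar_prod_def)
    then show ?thesis using neg v q[OF v] by (auto simp: quad_le_def)
  qed
  have "cmat H * cmat L = cmat (H * L)" using H L by (simp add: of_real_hom.mat_hom_mult[of _ N N])
  then have "weighted_inner (cmat H) x (cmat L *\<^sub>v x) = weighted_inner (cmat (H * L)) x x"
    using weighted_inner_mult[of "cmat H" N "cmat L" x x] H L x by simp
  also have "Re \<dots> \<le> 0"
    unfolding weighted_inner_cmat_Re[OF HL x] using x by (intro add_nonpos_nonpos n) auto
  finally show ?thesis .
qed

lemma cmod_component_le_l2_norm:
  assumes "i < dim_vec x"
  shows "cmod (x $ i) \<le> l2_norm x"
  unfolding l2_norm_def by (rule member_le_L2_set) (use assms in auto)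

lemma l2_norm_eq_0: "x \<in> carrier_vec N \<Longrightarrow> l2_norm x = 0 \<Longrightarrow> x = 0\<^sub>v N"
  using cmod_component_le_l2_norm[of _ x] by (auto simp: vec_eq_iff)

lemma weighted_inner_symmetric:
  assumes H: "H \<in> carrier_mat N N" and sym: "transpose_mat H = H"
    and x: "x \<in> carrier_vec N" and y: "y \<in> carrier_vec N"
  shows "weighted_inner (cmat H) y x = cnj (weighted_inner (cmat H) x y)"
proof -
  have cH: "cmat H \<in> carrier_mat N N" using H by simp
  have s: "H $$ (i, j) = H $$ (j, i)" if "i < N" "j < N" for i j
    using arg_cong[OF sym, of "\<lambda>M. M $$ (j, i)"] that H by simp
  have "weighted_inner (cmat H) y x = (\<Sum>j<N. \<Sum>i<N. cnj (y $ i) * cmat H $$ (i, j) * x $ j)"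
    unfolding weighted_inner_sum[OF cH y x] by (rule sum.swap)
  also have "\<dots> = cnj (weighted_inner (cmat H) x y)"
    unfolding weighted_inner_sum[OF cH x y] cnj_sum
    using H s by (intro sum.cong refl) (auto simp: mult_ac)
  finally show ?thesis .
qed

text \<open>
  A real symmetric weight \<open>H\<close> between \<open>inverse K\<close> and \<open>K\<close>, as a weight on \<open>\<complex>\<^sup>N\<close>.
\<close>

locale equivalent_weight =
  fixes N :: nat and H :: "real mat" and K :: real
  assumes H_carrier: "H \<in> carrier_mat N N" and sym: "transpose_mat H = H"
    and K_pos: "0 < K"
    and lower: "quad_le N (inverse K \<cdot>\<^sub>m 1\<^sub>m N) H" and upper: "quad_le N H (K \<cdot>\<^sub>m 1\<^sub>m N)"
begin

lemma cmat_carrier: "cmat H \<in> carrier_mat N N" using H_carrier by simp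

lemma weighted_inner_bounds:
  assumes "x \<in> carrier_vec N"
  shows "inverse K * (l2_norm x)\<^sup>2 \<le> Re (weighted_inner (cmat H) x x)"
    and "Re (weighted_inner (cmat H) x x) \<le> K * (l2_norm x)\<^sup>2"
  using quad_le_imp_weighted_inner_le[OF lower _ H_carrier assms] quad_le_imp_weighted_inner_le[OF upper H_carrier _ assms]
  unfolding weighted_inner_scalar[OF assms] by auto

sublocale weighted_space N "cmat H"
proof
  show "cmat H \<in> carrier_mat N N" by (rule cmat_carrier)
  show "weighted_inner (cmat H) y x = cnj (weighted_inner (cmat H) x y)"
    if "x \<in> carrier_vec N" "y \<in> carrier_vec N" for x y
    by (rule weighted_inner_symmetric[OF H_carrier sym that])
  fix x :: "complex vec" assume x: "x \<in> carrier_vec N" "x \<noteq> 0\<^sub>v N"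
  then have "l2_norm x \<noteq> 0" using l2_norm_eq_0 by blast
  then have "0 < inverse K * (l2_norm x)\<^sup>2" using K_pos by (intro mult_pos_pos) auto
  then show "0 < Re (weighted_inner (cmat H) x x)" using weighted_inner_bounds(1)[OF x(1)] by linarith
qed

lemma l2_norm_nonneg: "0 \<le> l2_norm x" by (simp add: l2_norm_def L2_set_nonneg)

lemma l2_norm_le: "x \<in> carrier_vec N \<Longrightarrow> l2_norm x \<le> sqrt K * weighted_norm (cmat H) x"
proof -
  assume x: "x \<in> carrier_vec N"
  have "(l2_norm x)\<^sup>2 \<le> K * Re (weighted_inner (cmat H) x x)"
    using weighted_inner_bounds(1)[OF x] K_pos by (simp add: field_simps)
  then have "sqrt ((l2_norm x)\<^sup>2) \<le> sqrt (K * Re (weighted_inner (cmat H) x x))" by (rule real_sqrt_le_mono)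
  then show ?thesis by (simp add: weighted_norm_def real_sqrt_mult l2_norm_nonneg)
qed

lemma weighted_norm_le: "x \<in> carrier_vec N \<Longrightarrow> weighted_norm (cmat H) x \<le> sqrt K * l2_norm x"
proof -
  assume x: "x \<in> carrier_vec N"
  have "sqrt (Re (weighted_inner (cmat H) x x)) \<le> sqrt (K * (l2_norm x)\<^sup>2)"
    by (rule real_sqrt_le_mono[OF weighted_inner_bounds(2)[OF x]])
  then show ?thesis by (simp add: weighted_norm_def real_sqrt_mult l2_norm_nonneg)
qed

text \<open>
  The supremum defining the numerical radius is informative only because the set is bounded.
\<close>

lemma numerical_radius_bdd_above:
  assumes L: "L \<in> carrier_mat N N"
  shows "bdd_above ((\<lambda>x. cmod (weighted_inner (cmat H) (L *\<^sub>v x) x))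
    ` {x \<in> carrier_vec (dim_row (cmat H)). weighted_norm (cmat H) x = 1})"
proof (rule bdd_aboveI2)
  fix x assume "x \<in> {x \<in> carrier_vec (dim_row (cmat H)). weighted_norm (cmat H) x = 1}"
  then have x: "x \<in> carrier_vec N" and n: "weighted_norm (cmat H) x = 1" using H_carrier by auto
  have M: "cmat H * L \<in> carrier_mat N N" using cmat_carrier L by simp
  have Lx: "L *\<^sub>v x \<in> carrier_vec N" using L x by auto
  have c: "cmod (x $ i) \<le> sqrt K" if "i < N" for i
    using cmod_component_le_l2_norm[of i x] l2_norm_le[OF x] n x that by auto
  have "cmod (weighted_inner (cmat H) (L *\<^sub>v x) x) = cmod (weighted_inner (cmat H * L) x x)"
    using hermitian[OF x Lx] weighted_inner_mult[OF cmat_carrier L x, of x] by simp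
  also have "\<dots> \<le> (\<Sum>i<N. \<Sum>j<N. sqrt K * cmod ((cmat H * L) $$ (i, j)) * sqrt K)"
    unfolding weighted_inner_sum[OF M x x]
  proof (intro order.trans[OF norm_sum] sum_mono)
    fix i j assume ij: "i \<in> {..<N}" "j \<in> {..<N}"
    show "cmod (cnj (x $ i) * (cmat H * L) $$ (i, j) * x $ j) \<le> sqrt K * cmod ((cmat H * L) $$ (i, j)) * sqrt K"
      unfolding norm_mult complex_mod_cnj using c ij K_pos by (intro mult_mono) auto
  qed
  finally show "cmod (weighted_inner (cmat H) (L *\<^sub>v x) x) \<le> (\<Sum>i<N. \<Sum>j<N. sqrt K * cmod ((cmat H * L) $$ (i, j)) * sqrt K)" .
qed

lemma weighted_inner_le_numerical_radius:
  assumes L: "L \<in> carrier_mat N N" and x: "x \<in> carrier_vec N"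
  shows "cmod (weighted_inner (cmat H) x (L *\<^sub>v x)) \<le> numerical_radius (cmat H) L * (weighted_norm (cmat H) x)\<^sup>2"
proof (cases "x = 0\<^sub>v N")
  case True
  then have "L *\<^sub>v x = 0\<^sub>v N" using L by auto
  then show ?thesis using True by simp
next
  case False
  define w where "w = weighted_norm (cmat H) x"
  have w: "0 < w" unfolding w_def by (rule norm_pos[OF x False])
  define e where "e = complex_of_real (1 / w) \<cdot>\<^sub>v x"
  have e: "e \<in> carrier_vec N" using x by (simp add: e_def)
  have n: "weighted_norm (cmat H) e = 1"
    unfolding e_def norm_smult[OF x] w_def[symmetric] using w by (simp add: norm_divide)
  have Lx: "L *\<^sub>v x \<in> carrier_vec N" using L x by auto
  have Le: "L *\<^sub>v e = complex_of_real (1 / w) \<cdot>\<^sub>v (L *\<^sub>v x)"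
    unfolding e_def by (rule mult_mat_vec[OF L x])
  have "cmod (weighted_inner (cmat H) (L *\<^sub>v e) e) \<le> numerical_radius (cmat H) L"
    unfolding numerical_radius_def using e n H_carrier by (intro cSUP_upper numerical_radius_bdd_above[OF L]) auto
  also have "weighted_inner (cmat H) (L *\<^sub>v e) e = of_real ((1 / w) * (1 / w)) * weighted_inner (cmat H) (L *\<^sub>v x) x"
    unfolding Le using x Lx e
    by (simp add: e_def weighted_inner_smult_left[OF cmat_carrier] weighted_inner_smult_right[OF cmat_carrier])
  also have "cmod \<dots> = cmod (weighted_inner (cmat H) x (L *\<^sub>v x)) / w\<^sup>2"
    using hermitian[OF x Lx] w by (simp add: norm_mult norm_divide power2_eq_square)
  finally show ?thesis using w by (simp add: w_def[symmetric] field_simps)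
qed

end

section \<open>Stability under the CFL condition\<close>

theorem theorem4p4:
  fixes p :: "real poly" and s :: nat and R :: real
  assumes deg: "Polynomial.degree p = s"
    and coeff_0: "Polynomial.coeff p 0 = 1"
    and coeff_1: "Polynomial.coeff p 1 = 1"
    and R_pos: "0 < R"
    and imaginary_interval:
      "\<forall>\<sigma>\<in>{-R..R}. cmod (poly (map_poly complex_of_real p) (\<i> * complex_of_real \<sigma>)) \<le> 1"
  shows "\<exists>C. 0 < C \<and> C < R \<and>
    (\<forall>(K::real) (N::nat) (L::real mat) (H::real mat) (dt::real) u.
       0 < N \<and> L \<in> carrier_mat N N \<and> H \<in> carrier_mat N N \<and>
       transpose_mat H = H \<and>
       quad_le N (transpose_mat L * H + H * L) (0\<^sub>m N N) \<and>
       0 < inverse K \<and>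
       quad_le N (inverse K \<cdot>\<^sub>m 1\<^sub>m N) H \<and> quad_le N H (K \<cdot>\<^sub>m 1\<^sub>m N) \<and>
       0 < dt \<and> dt * numerical_radius (cmat H) (cmat L) \<le> C \<and>
       u 0 \<in> carrier_vec N \<and>
       (\<forall>n. u (Suc n) = cmat (mat_poly p (dt \<cdot>\<^sub>m L)) *\<^sub>v u n)
       \<longrightarrow> (\<forall>n\<ge>1. l2_norm (u n) \<le> (1 + sqrt 2) * K * l2_norm (u 0)))"
proof -
  define q where "q = map_poly complex_of_real p"
  obtain \<rho>\<^sub>0 where \<rho>\<^sub>0: "0 < \<rho>\<^sub>0" "\<rho>\<^sub>0 \<le> R"
    and stable: "\<And>z. Re z \<le> 0 \<Longrightarrow> cmod z \<le> \<rho>\<^sub>0 \<Longrightarrow> cmod (poly q z) \<le> 1"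
    using half_disc_stability[OF coeff_0 coeff_1 R_pos] imaginary_interval unfolding q_def by blast
  \<comment> \<open>The contour has half the radius of the stable half disc, which leaves room for the shift by \<open>\<delta>\<close>
    below. The CFL constant makes \<open>2 * \<rho> / (\<rho> - r)\<close> at most \<open>20 / 9\<close> for \<open>r = C + \<delta> \<le> \<rho> / 10\<close>.\<close>
  define \<rho> where "\<rho> = \<rho>\<^sub>0 / 2"
  have \<rho>: "0 < \<rho>" using \<rho>\<^sub>0 by (simp add: \<rho>_def)
  define C where "C = \<rho> / 20"
  have C: "0 < C" "C < R" using \<rho>\<^sub>0 by (auto simp: C_def \<rho>_def)
  have bound: "l2_norm (u n) \<le> (1 + sqrt 2) * K * l2_norm (u 0)"
    if L: "L \<in> carrier_mat N N" and H: "H \<in> carrier_mat N N" and sym: "transpose_mat H = H"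
      and neg: "quad_le N (transpose_mat L * H + H * L) (0\<^sub>m N N)"
      and K: "0 < inverse K" and lo: "quad_le N (inverse K \<cdot>\<^sub>m 1\<^sub>m N) H" and up: "quad_le N H (K \<cdot>\<^sub>m 1\<^sub>m N)"
      and dt: "0 < dt" and cfl: "dt * numerical_radius (cmat H) (cmat L) \<le> C"
      and u0: "u 0 \<in> carrier_vec N" and u: "\<And>n. u (Suc n) = cmat (mat_poly p (dt \<cdot>\<^sub>m L)) *\<^sub>v u n"
    for K dt :: real and N :: nat and L H :: "real mat" and u :: "nat \<Rightarrow> complex vec" and n :: nat
  proof -
    interpret equivalent_weight N H K
      by unfold_locales (use H sym K lo up in auto)
    let ?n = "weighted_norm (cmat H)"
    define A where "A = cmat (dt \<cdot>\<^sub>m L)"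
    have cL: "cmat L \<in> carrier_mat N N" using L by simp
    have A: "A \<in> carrier_mat N N" using L by (simp add: A_def)
    have Ax: "A *\<^sub>v x = complex_of_real dt \<cdot>\<^sub>v (cmat L *\<^sub>v x)" if "x \<in> carrier_vec N" for x
    proof -
      have "A = complex_of_real dt \<cdot>\<^sub>m cmat L" unfolding A_def by (rule eq_matI) auto
      then show ?thesis using smult_mat_mult_vec[OF cL that] by simp
    qed
    have inner_A: "weighted_inner (cmat H) x (A *\<^sub>v x) = dt * weighted_inner (cmat H) x (cmat L *\<^sub>v x)"
      if x: "x \<in> carrier_vec N" for x
      unfolding Ax[OF x] using cL x by (intro weighted_inner_smult_right[OF cmat_carrier]) auto
    have A_diss: "Re (weighted_inner (cmat H) x (A *\<^sub>v x)) \<le> 0" if x: "x \<in> carrier_vec N" for x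
      unfolding inner_A[OF x] using negative_imp_dissipative[OF L H_carrier sym neg x] dt by (simp add: mult_nonneg_nonpos)
    have A_rad: "cmod (weighted_inner (cmat H) x (A *\<^sub>v x)) \<le> C * (?n x)\<^sup>2" if x: "x \<in> carrier_vec N" for x
    proof -
      have "cmod (weighted_inner (cmat H) x (A *\<^sub>v x)) \<le> dt * (numerical_radius (cmat H) (cmat L) * (?n x)\<^sup>2)"
        unfolding inner_A[OF x] using weighted_inner_le_numerical_radius[OF cL x] dt by (simp add: norm_mult)
      also have "\<dots> \<le> C * (?n x)\<^sup>2"
        unfolding mult.assoc[symmetric] by (rule mult_right_mono[OF cfl]) simp
      finally show ?thesis .
    qed
    \<comment> \<open>The shift \<open>\<delta>\<close> that makes \<open>A\<close> strictly dissipative may depend on \<open>n\<close>: it is chosen so small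
      that shifting the argument changes the \<open>n\<close>-th power of the polynomial by at most \<open>1 / 20\<close>.\<close>
    have "uniformly_continuous_on (cball 0 \<rho>\<^sub>0) (\<lambda>z. poly q z ^ n)"
      by (intro compact_uniformly_continuous continuous_intros) auto
    then obtain d where d: "0 < d" "\<And>z w. z \<in> cball 0 \<rho>\<^sub>0 \<Longrightarrow> w \<in> cball 0 \<rho>\<^sub>0 \<Longrightarrow> dist w z < d \<Longrightarrow>
        dist (poly q w ^ n) (poly q z ^ n) < 1 / 20"
      unfolding uniformly_continuous_on_def by (auto dest!: spec[of _ "1/20::real"])
    define \<delta> where "\<delta> = min (d / 2) C"
    have \<delta>_bounds: "0 < \<delta>" "\<delta> < d" "\<delta> \<le> C" using d(1) C by (auto simp: \<delta>_def)
    define B where "B = A - of_real \<delta> \<cdot>\<^sub>m 1\<^sub>m N"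
    have B: "B \<in> carrier_mat N N" unfolding B_def by (rule minus_carrier_mat) simp
    have Bx: "B *\<^sub>v x = A *\<^sub>v x - of_real \<delta> \<cdot>\<^sub>v x" if "x \<in> carrier_vec N" for x
      unfolding B_def using A that by (subst minus_mult_distrib_mat_vec[of _ N N]) (auto simp: smult_mat_mult_vec[of _ N])
    have AB: "A *\<^sub>v x = B *\<^sub>v x + of_real \<delta> \<cdot>\<^sub>v x" if x: "x \<in> carrier_vec N" for x
    proof -
      have "A *\<^sub>v x \<in> carrier_vec N" using A x by auto
      then show ?thesis unfolding Bx[OF x] using x A by (auto simp: vec_eq_iff)
    qed
    have inner_B: "weighted_inner (cmat H) x (B *\<^sub>v x) = weighted_inner (cmat H) x (A *\<^sub>v x) - of_real (\<delta> * (?n x)\<^sup>2)"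
      if x: "x \<in> carrier_vec N" for x
    proof -
      have Bc: "B *\<^sub>v x \<in> carrier_vec N" using B x by auto
      show ?thesis
        unfolding AB[OF x] weighted_inner_add_right[OF cmat_carrier x Bc smult_carrier_vec[THEN iffD2, OF x]]
          weighted_inner_smult_right[OF cmat_carrier x x] inner_self[OF x] by simp
    qed
    interpret dissipative_matrix N "cmat H" B "C + \<delta>" \<delta>
    proof unfold_locales
      show "Re (weighted_inner (cmat H) x (B *\<^sub>v x)) \<le> - \<delta> * (?n x)\<^sup>2" if x: "x \<in> carrier_vec N" for x
        unfolding inner_B[OF x] using A_diss[OF x] by simp
      show "cmod (weighted_inner (cmat H) x (B *\<^sub>v x)) \<le> (C + \<delta>) * (?n x)\<^sup>2" if x: "x \<in> carrier_vec N" for x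
      proof -
        have "cmod (weighted_inner (cmat H) x (B *\<^sub>v x)) \<le> cmod (weighted_inner (cmat H) x (A *\<^sub>v x)) + cmod (of_real (\<delta> * (?n x)\<^sup>2))"
          unfolding inner_B[OF x] by (rule norm_triangle_ineq4)
        also have "cmod (of_real (\<delta> * (?n x)\<^sup>2)) = \<delta> * (?n x)\<^sup>2" using \<delta>_bounds by (simp add: norm_mult norm_power)
        finally show ?thesis using A_rad[OF x] by (simp add: distrib_right)
      qed
    qed (use B \<delta>_bounds C in auto)
    have u': "u (Suc k) = mat_poly q A *\<^sub>v u k" for k
      unfolding u q_def A_def by (subst cmat_mat_poly[of _ N]) (use L in auto)
    have P: "mat_poly q A \<in> carrier_mat N N" using A by (simp add: mat_poly_def)
    have uc: "u k \<in> carrier_vec N" for k using u0 P by (induction k) (auto simp: u')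
    have "?n (u n) \<le> 2 * \<rho> / (\<rho> - (C + \<delta>)) * (21/20) * ?n (u 0)"
    proof (rule power_bound[OF _ A AB _ _ u0 u'])
      show "2 * (C + \<delta>) < \<rho>" using \<delta>_bounds \<rho> by (simp add: C_def)
      show "cnj (poly q z) = poly q (cnj z)" for z
        unfolding q_def by (rule poly_cnj_real) (simp add: coeff_map_poly)
      fix z assume z: "Re z \<le> 0" "cmod z \<le> \<rho>"
      have "cmod (z + of_real \<delta>) \<le> \<rho> + \<delta>" using z \<delta>_bounds norm_triangle_ineq[of z "of_real \<delta>"] by simp
      also have "\<dots> \<le> \<rho>\<^sub>0" using \<delta>_bounds \<rho> by (simp add: C_def \<rho>_def)
      finally have "z + of_real \<delta> \<in> cball 0 \<rho>\<^sub>0" unfolding mem_cball_0 .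
      moreover have "z \<in> cball 0 \<rho>\<^sub>0" unfolding mem_cball_0 using z \<rho> by (simp add: \<rho>_def)
      moreover have "dist (z + of_real \<delta>) z < d" using \<delta>_bounds by (simp add: dist_norm)
      ultimately have "dist (poly q (z + of_real \<delta>) ^ n) (poly q z ^ n) < 1 / 20" by (intro d(2))
      moreover have "cmod (poly q z ^ n) \<le> 1"
        using stable[of z] z \<rho> by (simp add: \<rho>_def norm_power power_le_one)
      ultimately show "cmod (poly q (z + of_real \<delta>) ^ n) \<le> 21/20"
        using norm_triangle_sub[of "poly q (z + of_real \<delta>) ^ n" "poly q z ^ n"] by (simp add: dist_norm)
    qed
    also have "\<dots> \<le> (1 + sqrt 2) * ?n (u 0)"
    proof (rule mult_right_mono)
      have "C + \<delta> \<le> \<rho> / 10" using \<delta>_bounds by (simp add: C_def)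
      then have "2 * \<rho> / (\<rho> - (C + \<delta>)) \<le> 2 * \<rho> / (\<rho> - \<rho> / 10)" using \<rho> by (intro divide_left_mono mult_pos_pos) auto
      also have "\<dots> = 20 / 9" using \<rho> by (simp add: field_simps)
      finally have "2 * \<rho> / (\<rho> - (C + \<delta>)) * (21/20) \<le> 20 / 9 * (21/20)"
        by (rule mult_right_mono) simp
      also have "20 / 9 * (21/20) \<le> 1 + sqrt 2"
      proof -
        have "4 / 3 \<le> sqrt 2" by (rule real_le_rsqrt) (simp add: power2_eq_square)
        then show ?thesis by simp
      qed
      finally show "2 * \<rho> / (\<rho> - (C + \<delta>)) * (21/20) \<le> 1 + sqrt 2" .
    qed (rule norm_nonneg[OF u0])
    finally have wn: "?n (u n) \<le> (1 + sqrt 2) * ?n (u 0)" .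
    have "l2_norm (u n) \<le> sqrt K * ?n (u n)" by (rule l2_norm_le[OF uc])
    also have "\<dots> \<le> sqrt K * ((1 + sqrt 2) * (sqrt K * l2_norm (u 0)))"
      using wn weighted_norm_le[OF u0] K_pos
      by (intro mult_left_mono order.trans[OF wn]) auto
    also have "\<dots> = (1 + sqrt 2) * K * l2_norm (u 0)"
      using K_pos by simp
    finally show ?thesis .
  qed
  show ?thesis
    by (intro exI[of _ C] conjI C allI impI, elim conjE) (rule bound, auto)
qed

end
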